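(* Let $h:\mathbb{R}^d\to\mathbb{R}$ be differentiable with minimizer $x^\star$, and assume $h(x)=h_1(x)+h_2(x)$ for all $x\in\mathbb{R}^d$ and that we can evaluate $h_2(x)$ for any $x\in\mathbb{R}^d$. Further, suppose $S:=\{x_i\}_{i\in[k]}\subset\mathbb{R}^d$ has $\|x_i-x_j\|\le R$ for all $i,j\in[k]$, and $\min_{i\in[k]}h(x_i)-h(x^\star)\le\epsilon$. Finally, suppose $g_1(x)$ is an unbiased estimate for $\nabla h_1(x)$ and $\mathbb{E}[\|g_1(x)\|^2]\le L^2$ for all $x$ in the convex hull of $S$. For $\delta\in(0,1)$, there is an algorithm which returns $x\in S$ with $h(x)-h(x^\star)\le2\epsilon$ with probability $\ge1-\delta$, using $$O\left(\frac{L^2R^2}{\epsilon^2}\cdot k\log\left(\frac{\log k}{\delta}\right)\right)\text{ queries to } g_1\text{ and } k\text{ evaluations of } h_2.$$ The query depth used is $O(\log(k))$, and the computational depth used is $O\left((\log(d)+\log\log(\tfrac k\delta))\log(k)\right)$.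
   Context: $[k]=\{1,\dots,k\}$; $\|\cdot\|$ is the Euclidean norm. The query depth is the number of sequential rounds of (batched) queries to the stochastic gradient estimator $g_1$ (independent randomness on each query); the computational depth is the number of sequential rounds of computation outside of querying. Parallel model: all vector operations in $\mathbb{R}^d$ (e.g. addition and scalar multiplication) require $O(d)$ work and $O(1)$ depth; all matrix-vector multiplications (including dot products) require $O(\log d)$ depth. *)

theory Defs
  imports "HOL-Probability.Probability"
begin

text \<open>
  A parallel random access machine with a stochastic gradient oracle \<open>g1\<close> and a value oracle \<open>h2\<close>.
  It has scalar registers and registers holding vectors of \<open>real ^ 'n\<close>. A program is a list of
  rounds. A round consists of arbitrarily many operations which all read the memory as it was before
  the round; it is either a batch of elementary computations or a batch of queries to \<open>g1\<close>.
  Programs mention register names and real constants only, so they know nothing of the functions,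
  of the points or of the law of \<open>g1\<close> beyond what they compute from the inputs and the oracle answers.
\<close>

datatype sinstr =
    SConst real
  | SUnif                        \<comment> \<open>fresh uniform sample from \<open>[0,1]\<close>\<close>
  | SAdd nat nat
  | SMul nat nat
  | SIfLe nat nat nat nat        \<comment> \<open>\<open>SIfLe a b c e\<close>: if \<open>a \<le> b\<close> then \<open>c\<close> else \<open>e\<close>\<close>
  | SInner nat nat               \<comment> \<open>dot product of two vector registers\<close>
  | SDot "(nat \<times> nat) list"      \<comment> \<open>dot product of two arrays of scalar registers\<close>
  | is_SEvalH2: SEvalH2 nat                \<comment> \<open>value of \<open>h2\<close> at a vector register\<close>

datatype vinstr =
    VAdd nat nat
  | VScale nat nat               \<comment> \<open>scalar register times vector register\<close>
  | VIfLe nat nat nat nat        \<comment> \<open>compares two scalar registers, selects a vector register\<close>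

text \<open>
  The pairs are (destination, instruction) in \<open>Compute\<close> and (destination, register holding the query
  point) in \<open>Query\<close>. If a destination is listed twice in a round, the first entry counts.
\<close>

datatype phase =
    Compute "(nat \<times> sinstr) list" "(nat \<times> vinstr) list"
  | is_Query: Query "(nat \<times> nat) list"

datatype algorithm = Algorithm (phases: "phase list") (out_reg: nat)

fun eval_sinstr ::
  "(real ^ 'n \<Rightarrow> real) \<Rightarrow> real \<Rightarrow> (nat \<Rightarrow> real) \<Rightarrow> (nat \<Rightarrow> real ^ 'n) \<Rightarrow> sinstr \<Rightarrow> real" where
  "eval_sinstr h2 u s v (SConst c) = c"
| "eval_sinstr h2 u s v SUnif = u"
| "eval_sinstr h2 u s v (SAdd a b) = s a + s b"
| "eval_sinstr h2 u s v (SMul a b) = s a * s b"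
| "eval_sinstr h2 u s v (SIfLe a b c e) = (if s a \<le> s b then s c else s e)"
| "eval_sinstr h2 u s v (SInner a b) = v a \<bullet> v b"
| "eval_sinstr h2 u s v (SDot ps) = (\<Sum>(a, b) \<leftarrow> ps. s a * s b)"
| "eval_sinstr h2 u s v (SEvalH2 a) = h2 (v a)"

fun eval_vinstr :: "(nat \<Rightarrow> real) \<Rightarrow> (nat \<Rightarrow> real ^ 'n) \<Rightarrow> vinstr \<Rightarrow> real ^ 'n" where
  "eval_vinstr s v (VAdd a b) = v a + v b"
| "eval_vinstr s v (VScale a b) = s a *\<^sub>R v b"
| "eval_vinstr s v (VIfLe a b c e) = (if s a \<le> s b then v c else v e)"

text \<open>
  The oracle is a random function: \<open>g1 x w\<close> is its answer at \<open>x\<close> for the seed \<open>w\<close>. The randomness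
  \<open>\<xi> r\<close> of a round for destination \<open>r\<close> is a uniform sample together with a seed.
\<close>

fun exec_phase ::
  "(real ^ 'n \<Rightarrow> real) \<Rightarrow> (real ^ 'n \<Rightarrow> 'w \<Rightarrow> real ^ 'n) \<Rightarrow> (nat \<Rightarrow> real \<times> 'w) \<Rightarrow> phase \<Rightarrow>
   (nat \<Rightarrow> real) \<times> (nat \<Rightarrow> real ^ 'n) \<Rightarrow> (nat \<Rightarrow> real) \<times> (nat \<Rightarrow> real ^ 'n)" where
  "exec_phase h2 g1 \<xi> (Compute ss vs) (s, v) =
     ((\<lambda>r. case map_of ss r of None \<Rightarrow> s r | Some i \<Rightarrow> eval_sinstr h2 (fst (\<xi> r)) s v i),
      (\<lambda>r. case map_of vs r of None \<Rightarrow> v r | Some i \<Rightarrow> eval_vinstr s v i))"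
| "exec_phase h2 g1 \<xi> (Query qs) (s, v) =
     (s, (\<lambda>r. case map_of qs r of None \<Rightarrow> v r | Some a \<Rightarrow> g1 (v a) (snd (\<xi> r))))"

text \<open>Round number \<open>t\<close> uses the coordinates \<open>(t, r)\<close> of \<open>\<omega>\<close>, so no randomness is used twice.\<close>

fun exec_from ::
  "(real ^ 'n \<Rightarrow> real) \<Rightarrow> (real ^ 'n \<Rightarrow> 'w \<Rightarrow> real ^ 'n) \<Rightarrow> (nat \<times> nat \<Rightarrow> real \<times> 'w) \<Rightarrow> nat \<Rightarrow>
   phase list \<Rightarrow> (nat \<Rightarrow> real) \<times> (nat \<Rightarrow> real ^ 'n) \<Rightarrow> (nat \<Rightarrow> real) \<times> (nat \<Rightarrow> real ^ 'n)" where
  "exec_from h2 g1 \<omega> t [] m = m"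
| "exec_from h2 g1 \<omega> t (p # ps) m =
     exec_from h2 g1 \<omega> (Suc t) ps (exec_phase h2 g1 (\<lambda>r. \<omega> (t, r)) p m)"

definition init_mem ::
  "nat \<Rightarrow> (nat \<Rightarrow> real ^ 'n) \<Rightarrow> (nat \<Rightarrow> real) \<times> (nat \<Rightarrow> real ^ 'n)" where
  "init_mem k x = ((\<lambda>_. 0), (\<lambda>r. if r \<in> {1..k} then x r else 0))"

definition alg_result ::
  "algorithm \<Rightarrow> nat \<Rightarrow> (nat \<Rightarrow> real ^ 'n) \<Rightarrow> (real ^ 'n \<Rightarrow> real) \<Rightarrow>
   (real ^ 'n \<Rightarrow> 'w \<Rightarrow> real ^ 'n) \<Rightarrow> (nat \<times> nat \<Rightarrow> real \<times> 'w) \<Rightarrow> real ^ 'n" where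
  "alg_result A k x h2 g1 \<omega> = snd (exec_from h2 g1 \<omega> 0 (phases A) (init_mem k x)) (out_reg A)"

definition coins :: "'w measure \<Rightarrow> (nat \<times> nat \<Rightarrow> real \<times> 'w) measure" where
  "coins W = (\<Pi>\<^sub>M p\<in>UNIV. uniform_measure lborel {0..1} \<Otimes>\<^sub>M W)"

text \<open>
  Depth: every dot product (a matrix-vector product is a parallel batch of them, one per row) costs
  \<open>1 + \<lceil>log 2 d\<rceil>\<close>, where \<open>d\<close> is the dimension of the ambient space; this is the convention that
  all matrix-vector products, of whatever shape, have depth \<open>O(log d)\<close>. Everything else, including
  the evaluation of \<open>h2\<close>, costs 1.
\<close>

fun sdepth :: "nat \<Rightarrow> sinstr \<Rightarrow> nat" where
  "sdepth d (SInner a b) = 1 + nat \<lceil>log 2 (real d)\<rceil>"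
| "sdepth d (SDot ps) = 1 + nat \<lceil>log 2 (real d)\<rceil>"
| "sdepth d _ = 1"

fun vdepth :: "vinstr \<Rightarrow> nat" where
  "vdepth _ = 1"

fun phase_depth :: "nat \<Rightarrow> phase \<Rightarrow> nat" where
  "phase_depth d (Compute ss vs) =
     Max (insert 0 (set (map (sdepth d \<circ> snd) ss) \<union> set (map (vdepth \<circ> snd) vs)))"
| "phase_depth d (Query qs) = 0"

fun phase_queries :: "phase \<Rightarrow> nat" where
  "phase_queries (Compute ss vs) = 0"
| "phase_queries (Query qs) = length qs"

fun phase_h2_evals :: "phase \<Rightarrow> nat" where
  "phase_h2_evals (Compute ss vs) = length (filter (\<lambda>(r, i). is_SEvalH2 i) ss)"
| "phase_h2_evals (Query qs) = 0"

definition computational_depth :: "nat \<Rightarrow> algorithm \<Rightarrow> nat" where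
  "computational_depth d A = (\<Sum>p \<leftarrow> phases A. phase_depth d p)"

definition query_depth :: "algorithm \<Rightarrow> nat" where
  "query_depth A = length (filter is_Query (phases A))"

definition num_queries :: "algorithm \<Rightarrow> nat" where
  "num_queries A = (\<Sum>p \<leftarrow> phases A. phase_queries p)"

definition num_h2_evals :: "algorithm \<Rightarrow> nat" where
  "num_h2_evals A = (\<Sum>p \<leftarrow> phases A. phase_h2_evals p)"

text \<open>
  Logarithms inside an \<open>O\<close>-bound whose argument may be at most \<open>e\<close>. For \<open>k \<ge> 3\<close> both
  \<open>ln k / \<delta>\<close> and \<open>ln (k / \<delta>)\<close> exceed \<open>ln 3 > 1\<close>, and there \<open>ln1\<close> and \<open>ln\<close> differ by
  at most a constant factor.
\<close>

definition ln1 :: "real \<Rightarrow> real" where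
  "ln1 y = max 1 (ln y)"

text \<open>
  The constant hidden in the \<open>O\<close>-bounds. It is a fixed number because a constant that is
  existentially quantified in a statement about the type \<open>real ^ 'n\<close> could depend on \<open>'n\<close>.
\<close>

definition O_const :: real where
  "O_const = 10 ^ 6"

end

theory Submission
  imports Defs "HOL-Library.Log_Nat"
begin

text \<open>
  The algorithm is a knockout tournament. In each round the surviving points are paired and the loser
  of every pair is dropped, so that about \<open>log 2 k\<close> rounds leave one point.

  A pair \<open>A\<close>, \<open>B\<close> is compared through the identity
  \<open>h1 A - h1 B = \<integral> \<nabla>h1 (B + u (A - B)) \<bullet> (A - B) du\<close> over \<open>[0,1]\<close>: a query at a uniformly random
  point of the segment, multiplied with \<open>A - B\<close>, is an unbiased estimate of this difference with
  second moment at most \<open>L\<^sup>2 R\<^sup>2\<close> (\<open>slope_moments\<close>). By Chebyshev, a mean of \<open>N\<close> such samples is off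
  by \<open>e\<close> or more with probability at most \<open>1 / 16\<close> as soon as \<open>N \<ge> 16 L\<^sup>2 R\<^sup>2 / e\<^sup>2\<close>. The signs of
  \<open>m\<close> independent means, each corrected by the known difference of \<open>h2\<close>, are put to a vote. The vote
  selects a point that is worse by more than \<open>e\<close> only if at least half of the means are off by \<open>e\<close>, which
  has probability at most \<open>(1 / 2) ^ m\<close> (\<open>duel_error\<close>). A vote replaces the median of means because
  a vote is a single sum, hence of depth one dot product.

  Two observations keep the cost down. First, in each round it is enough that the current best
  point either wins its match or loses to a point that is nearly as good; all other matches may be
  decided wrongly. As the randomness of a round is independent of the pairing, there is one
  failure event per round, of probability at most \<open>(1 / 2) ^ m\<close> (\<open>tournament\<close>). So \<open>m\<close> needs to
  grow like \<open>log (log k / \<delta>)\<close> only. Second, the number of matches halves from round to round, which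
  pays for increasing accuracy: with tolerance proportional to \<open>(3 / 4) ^ l\<close> in round \<open>l\<close> the
  tolerances add up to at most \<open>\<epsilon>\<close>, while the number of queries is proportional to
  \<open>k (1 / 2) ^ l (16 / 9) ^ l = k (8 / 9) ^ l\<close> and so is dominated by the first round.

  If \<open>L R \<le> \<epsilon>\<close>, the query bound may be less than one, and then no query is allowed. In this case
  \<open>h1\<close> varies by at most \<open>\<epsilon>\<close> between the points, and comparing the values of \<open>h2\<close> suffices. The
  same program does this if the batches are empty.
\<close>

section \<open>Means and majorities of independent samples\<close>

lemma (in prob_space) sum_centered_indep_second_moment:
  fixes X :: "'i \<Rightarrow> 'a \<Rightarrow> real"
  assumes "finite I"
    and "indep_vars (\<lambda>_. borel) X I"
    and "\<And>i. i \<in> I \<Longrightarrow> integrable M (\<lambda>\<omega>. (X i \<omega>)\<^sup>2)"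
    and "\<And>i. i \<in> I \<Longrightarrow> expectation (X i) = 0"
  shows "integrable M (\<lambda>\<omega>. (\<Sum>i\<in>I. X i \<omega>)\<^sup>2) \<and>
    expectation (\<lambda>\<omega>. (\<Sum>i\<in>I. X i \<omega>)\<^sup>2) = (\<Sum>i\<in>I. expectation (\<lambda>\<omega>. (X i \<omega>)\<^sup>2))"
  using assms
proof (induction I rule: finite_induct)
  case empty
  then show ?case by simp
next
  case (insert i I)
  let ?S = "\<lambda>\<omega>. \<Sum>i\<in>I. X i \<omega>"
  have X[measurable]: "random_variable borel (X j)" if "j \<in> insert i I" for j
    using insert.prems(1) that by (auto simp: indep_vars_def)
  have int: "integrable M (X j)" if "j \<in> insert i I" for j
    using insert.prems(2) X that by (blast intro: square_integrable_imp_integrable)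
  have IH: "integrable M (\<lambda>\<omega>. (?S \<omega>)\<^sup>2)"
      "expectation (\<lambda>\<omega>. (?S \<omega>)\<^sup>2) = (\<Sum>i\<in>I. expectation (\<lambda>\<omega>. (X i \<omega>)\<^sup>2))"
    using insert.IH insert.prems indep_vars_subset[OF insert.prems(1), of I] by auto
  have intS: "integrable M ?S"
    using int by auto
  have iv: "indep_var borel (X i) borel ?S"
    by (rule indep_vars_sum) (use insert in auto)
  have cross: "expectation (\<lambda>\<omega>. X i \<omega> * ?S \<omega>) = 0" "integrable M (\<lambda>\<omega>. X i \<omega> * ?S \<omega>)"
    using indep_var_lebesgue_integral[OF iv int intS] indep_var_integrable[OF iv int intS] insert.prems(3)
    by auto
  have sq: "(\<Sum>i\<in>insert i I. X i \<omega>)\<^sup>2 = (X i \<omega>)\<^sup>2 + 2 * (X i \<omega> * ?S \<omega>) + (?S \<omega>)\<^sup>2" for \<omega>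
    using insert.hyps by (simp add: power2_sum algebra_simps)
  show ?case
    unfolding sq using cross IH insert.hyps insert.prems(2)[of i] by simp
qed

text \<open>
  Chebyshev for a mean of \<open>N\<close> independent samples. The second moment may be used in place of the
  variance because centering only decreases it.
\<close>

lemma (in prob_space) mean_of_samples_deviation:
  fixes Y :: "nat \<Rightarrow> 'a \<Rightarrow> real"
  assumes indep: "indep_vars (\<lambda>_. borel) Y {..<N}"
    and sq: "\<And>i. i < N \<Longrightarrow> integrable M (\<lambda>\<omega>. (Y i \<omega>)\<^sup>2)"
    and mean: "\<And>i. i < N \<Longrightarrow> expectation (Y i) = \<mu>"
    and second: "\<And>i. i < N \<Longrightarrow> expectation (\<lambda>\<omega>. (Y i \<omega>)\<^sup>2) \<le> s"
    and "N > 0" "e > 0"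
  shows "prob {\<omega>\<in>space M. e \<le> \<bar>(\<Sum>i<N. Y i \<omega>) / real N - \<mu>\<bar>} \<le> s / (real N * e\<^sup>2)"
proof -
  define X where "X i \<omega> = Y i \<omega> - \<mu>" for i \<omega>
  have Y[measurable]: "random_variable borel (Y i)" if "i < N" for i
    using indep that by (auto simp: indep_vars_def)
  have int: "integrable M (Y i)" if "i < N" for i
    using sq Y that by (blast intro: square_integrable_imp_integrable)
  have iX: "indep_vars (\<lambda>_. borel) X {..<N}"
    unfolding X_def by (rule indep_vars_compose2[OF indep]) simp
  have sqX: "(X i \<omega>)\<^sup>2 = (Y i \<omega>)\<^sup>2 - 2 * \<mu> * Y i \<omega> + \<mu>\<^sup>2" for i \<omega>
    by (simp add: X_def power2_diff algebra_simps)
  have X2: "integrable M (\<lambda>\<omega>. (X i \<omega>)\<^sup>2)" "expectation (\<lambda>\<omega>. (X i \<omega>)\<^sup>2) \<le> s" "expectation (X i) = 0"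
    if "i < N" for i
  proof -
    show "integrable M (\<lambda>\<omega>. (X i \<omega>)\<^sup>2)" unfolding sqX using sq int that by auto
    have "expectation (\<lambda>\<omega>. (X i \<omega>)\<^sup>2) = expectation (\<lambda>\<omega>. (Y i \<omega>)\<^sup>2) - \<mu>\<^sup>2"
      unfolding sqX using sq int that mean[OF that] by (simp add: prob_space power2_eq_square)
    then show "expectation (\<lambda>\<omega>. (X i \<omega>)\<^sup>2) \<le> s"
      using second[OF that] by (smt (verit) zero_le_power2)
    show "expectation (X i) = 0"
      unfolding X_def using int that mean[OF that] by (simp add: prob_space)
  qed
  let ?S = "\<lambda>\<omega>. \<Sum>i<N. X i \<omega>"
  have S: "integrable M (\<lambda>\<omega>. (?S \<omega>)\<^sup>2)"
     "expectation (\<lambda>\<omega>. (?S \<omega>)\<^sup>2) = (\<Sum>i<N. expectation (\<lambda>\<omega>. (X i \<omega>)\<^sup>2))"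
    using sum_centered_indep_second_moment[OF _ iX] X2 by auto
  have [measurable]: "random_variable borel (X i)" if "i < N" for i
    unfolding X_def using Y[OF that] by measurable
  have "prob {\<omega>\<in>space M. e \<le> \<bar>(\<Sum>i<N. Y i \<omega>) / real N - \<mu>\<bar>}
      = prob {\<omega>\<in>space M. real N * e \<le> \<bar>?S \<omega>\<bar>}"
  proof -
    have "(\<Sum>i<N. Y i \<omega>) / real N - \<mu> = ?S \<omega> / real N" for \<omega>
      using \<open>N > 0\<close> by (simp add: X_def sum_subtractf field_simps)
    then show ?thesis
      using \<open>N > 0\<close> by (simp add: abs_divide pos_le_divide_eq mult.commute)
  qed
  also have "\<dots> \<le> expectation (\<lambda>\<omega>. (?S \<omega>)\<^sup>2) / (real N * e)\<^sup>2"
    by (rule second_moment_method) (use \<open>N > 0\<close> \<open>e > 0\<close> S in auto)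
  also have "\<dots> \<le> (real N * s) / (real N * e)\<^sup>2"
    unfolding S(2) using sum_bounded_above[of "{..<N}" "\<lambda>i. expectation (\<lambda>\<omega>. (X i \<omega>)\<^sup>2)" s] X2(2)
    by (intro divide_right_mono) auto
  also have "\<dots> = s / (real N * e\<^sup>2)"
    using \<open>N > 0\<close> \<open>e > 0\<close> by (simp add: power2_eq_square field_simps)
  finally show ?thesis .
qed

text \<open>
  A Chernoff bound: the product of \<open>16\<close> over the failed trials has mean at most
  \<open>(1 + 15 / 16) ^ m \<le> 2 ^ m\<close>, and it is at least \<open>4 ^ m\<close> if at least half of the trials fail. Markov then gives
  \<open>(2 / 4) ^ m\<close>.
\<close>

lemma (in prob_space) majority_fails:
  fixes D :: "nat \<Rightarrow> 'a \<Rightarrow> bool"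
  assumes indep: "indep_vars (\<lambda>_. count_space UNIV) D {..<m}"
    and p: "\<And>j. j < m \<Longrightarrow> prob {\<omega>\<in>space M. D j \<omega>} \<le> 1 / 16"
  shows "prob {\<omega>\<in>space M. m \<le> 2 * card {j. j < m \<and> D j \<omega>}} \<le> (1 / 2) ^ m"
proof -
  define F where "F j \<omega> = (if D j \<omega> then 16 else 1 :: real)" for j \<omega>
  have D[measurable]: "random_variable (count_space UNIV) (D j)" if "j < m" for j
    using indep that by (auto simp: indep_vars_def)
  have F: "indep_vars (\<lambda>_. borel) F {..<m}"
    unfolding F_def by (rule indep_vars_compose2[OF indep, where Y = "\<lambda>_ b. if b then 16 else 1"]) simp
  have EF: "integrable M (F j)" "expectation (F j) \<le> 2" if "j < m" for j
  proof -
    have [measurable]: "{\<omega>\<in>space M. D j \<omega>} \<in> events"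
      using D[OF that] by simp
    have eq: "F j \<omega> = 1 + 15 * indicator {\<omega>\<in>space M. D j \<omega>} \<omega>" if "\<omega> \<in> space M" for \<omega>
      using that by (simp add: F_def indicator_def)
    have "integrable M (F j) = integrable M (\<lambda>\<omega>. 1 + 15 * indicator {\<omega>\<in>space M. D j \<omega>} \<omega> :: real)"
      by (rule Bochner_Integration.integrable_cong) (auto simp: eq)
    then show "integrable M (F j)"
      by (simp add: emeasure_eq_measure)
    have "expectation (F j) = expectation (\<lambda>\<omega>. 1 + 15 * indicator {\<omega>\<in>space M. D j \<omega>} \<omega>)"
      by (rule Bochner_Integration.integral_cong) (auto simp: eq)
    also have "\<dots> = 1 + 15 * prob {\<omega>\<in>space M. D j \<omega>}"
      by (simp add: emeasure_eq_measure prob_space)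
    finally show "expectation (F j) \<le> 2"
      using p[OF that] by simp
  qed
  have prodF: "(\<Prod>j<m. F j \<omega>) = 16 ^ card {j. j < m \<and> D j \<omega>}" for \<omega>
  proof -
    have "(\<Prod>j<m. F j \<omega>) = (\<Prod>j\<in>{j\<in>{..<m}. D j \<omega>}. 16)"
      unfolding F_def by (subst prod.inter_filter) simp_all
    then show ?thesis by (simp add: lessThan_def Collect_conj_eq)
  qed
  have int: "integrable M (\<lambda>\<omega>. \<Prod>j<m. F j \<omega>)"
    by (rule indep_vars_integrable) (use F EF in auto)
  have "prob {\<omega>\<in>space M. m \<le> 2 * card {j. j < m \<and> D j \<omega>}} = prob {\<omega>\<in>space M. 4 ^ m \<le> (\<Prod>j<m. F j \<omega>)}"
  proof -
    have "(16::real) ^ c = 4 ^ (2 * c)" for c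
      by (simp add: power_mult)
    then show ?thesis by (simp add: prodF)
  qed
  also have "\<dots> \<le> expectation (\<lambda>\<omega>. \<Prod>j<m. F j \<omega>) / 4 ^ m"
    using int by (intro integral_Markov_inequality_measure[where A = "{}"]) (auto simp: prodF)
  also have "expectation (\<lambda>\<omega>. \<Prod>j<m. F j \<omega>) = (\<Prod>j<m. expectation (F j))"
    by (rule indep_vars_lebesgue_integral) (use F EF in auto)
  also have "\<dots> \<le> (\<Prod>j<m. 2)"
    by (intro prod_mono) (auto simp: EF intro!: Bochner_Integration.integral_nonneg simp: F_def)
  finally show ?thesis
    by (simp add: divide_right_mono flip: power_divide)
qed

section \<open>Knockout tournaments\<close>

text \<open>
  A test chosen from countably many by an observation \<open>X\<close> independent of the tested \<open>Z\<close> fails no more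
  often than the worst single test; no union bound over the possible choices is paid. Both
  variables take values in the same type because \<^const>\<open>prob_space.indep_var\<close> asks for that.
\<close>

lemma (in prob_space) prob_independent_choice_le:
  fixes S :: "'x \<Rightarrow> 'c :: countable" and X Z :: "'a \<Rightarrow> 'x"
  assumes indep: "indep_var N X T Z"
    and S[measurable]: "S \<in> measurable N (count_space UNIV)"
    and meas: "\<And>c. Measurable.pred T (bad c)"
    and le: "\<And>c. prob {\<omega>\<in>space M. bad c (Z \<omega>)} \<le> p"
  shows "prob {\<omega>\<in>space M. bad (S (X \<omega>)) (Z \<omega>)} \<le> p"
proof -
  have X[measurable]: "random_variable N X" and Z[measurable]: "random_variable T Z"
    using indep_var_rv1[OF indep] indep_var_rv2[OF indep] by auto
  let ?B = "{xz \<in> space (N \<Otimes>\<^sub>M T). bad (S (fst xz)) (snd xz)}"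
  interpret D: prob_space "distr M T Z" by (rule prob_space_distr) simp
  interpret D': prob_space "distr M N X" by (rule prob_space_distr) simp
  have [measurable]: "Measurable.pred (N \<Otimes>\<^sub>M T) (\<lambda>xz. bad (S (fst xz)) (snd xz))"
    by (rule measurable_compose_countable[where g = "\<lambda>xz. S (fst xz)"])
      (auto intro: measurable_compose[OF measurable_snd meas])
  have B[measurable]: "?B \<in> sets (N \<Otimes>\<^sub>M T)" by simp
  have "0 \<le> p" using le[of undefined] measure_nonneg order_trans by blast
  have "emeasure M {\<omega>\<in>space M. bad (S (X \<omega>)) (Z \<omega>)} = emeasure (distr M (N \<Otimes>\<^sub>M T) (\<lambda>x. (X x, Z x))) ?B"
    by (subst emeasure_distr) (auto intro!: arg_cong[where f = "emeasure M"]
        simp: space_pair_measure measurable_space[OF Z] measurable_space[OF X])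
  also have "\<dots> = emeasure (distr M N X \<Otimes>\<^sub>M distr M T Z) ?B"
    using indep by (simp add: indep_var_distribution_eq)
  also have "\<dots> = (\<integral>\<^sup>+x. emeasure (distr M T Z) (Pair x -` ?B) \<partial>distr M N X)"
    by (rule D.emeasure_pair_measure_alt) simp
  also have "\<dots> \<le> (\<integral>\<^sup>+x. ennreal p \<partial>distr M N X)"
  proof (rule nn_integral_mono)
    fix x assume "x \<in> space (distr M N X)"
    then have "Pair x -` ?B = {z\<in>space T. bad (S x) z}"
      by (auto simp: space_pair_measure)
    moreover have "{z\<in>space T. bad (S x) z} \<in> sets T"
      using meas[of "S x"] by (simp add: pred_def)
    moreover have "Z -` {z\<in>space T. bad (S x) z} \<inter> space M = {\<omega>\<in>space M. bad (S x) (Z \<omega>)}"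
      using measurable_space[OF Z] by auto
    ultimately have "emeasure (distr M T Z) (Pair x -` ?B) = emeasure M {\<omega>\<in>space M. bad (S x) (Z \<omega>)}"
      using emeasure_distr[OF Z] by simp
    also have "\<dots> \<le> ennreal p"
      using le[of "S x"] by (simp add: emeasure_eq_measure ennreal_leI)
    finally show "emeasure (distr M T Z) (Pair x -` ?B) \<le> ennreal p" .
  qed
  also have "\<dots> = ennreal p"
    using D'.emeasure_space_1 by simp
  finally show ?thesis
    using \<open>0 \<le> p\<close> by (simp add: emeasure_eq_measure)
qed

text \<open>
  Player \<open>i\<close> meets player \<open>i + half\<close>. A player without an opponent meets itself, which gives it a bye
  whatever the outcome.
\<close>

definition opponent :: "nat \<Rightarrow> nat \<Rightarrow> nat \<Rightarrow> nat" where
  "opponent half n i = (if i + half < n then i + half else i)"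

definition play_round :: "nat \<Rightarrow> (nat \<Rightarrow> 'p \<Rightarrow> 'p \<Rightarrow> bool) \<Rightarrow> 'p list \<Rightarrow> 'p list" where
  "play_round half wins ps =
     map (\<lambda>i. let a = ps ! i; b = ps ! opponent half (length ps) i in if wins i a b then a else b)
       [0..<half]"

text \<open>
  Players are numbered from \<open>1\<close>. The argument \<open>q\<close> is the total number of rounds; after round \<open>l\<close> the
  number of survivors is the power \<open>2 ^ (q - Suc l)\<close>, even if \<open>k\<close> is not a power of two, since the
  byes of round \<open>0\<close> even this out.
\<close>

fun survivors :: "nat \<Rightarrow> nat \<Rightarrow> (nat \<Rightarrow> nat \<Rightarrow> nat \<Rightarrow> nat \<Rightarrow> bool) \<Rightarrow> nat \<Rightarrow> nat list" where
  "survivors q k wins 0 = [1..<Suc k]"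
| "survivors q k wins (Suc l) = play_round (2 ^ (q - Suc l)) (wins l) (survivors q k wins l)"

definition players :: "nat \<Rightarrow> nat \<Rightarrow> nat \<Rightarrow> nat" where
  "players q k l = (if l = 0 then k else 2 ^ (q - l))"

lemma length_survivors: "length (survivors q k wins l) = players q k l"
  by (cases l) (simp_all add: play_round_def players_def)

lemma players_bounds:
  assumes "2 ^ (q - 1) < k" "k \<le> 2 ^ q" "l < q"
  shows "2 ^ (q - Suc l) \<le> players q k l" "players q k l \<le> 2 * 2 ^ (q - Suc l)"
proof -
  have "(2::nat) * 2 ^ (q - Suc l) = 2 ^ (q - l)"
    using assms(3) by (simp flip: power_Suc add: Suc_diff_Suc)
  then show "2 ^ (q - Suc l) \<le> players q k l" "players q k l \<le> 2 * 2 ^ (q - Suc l)"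
    using assms by (auto simp: players_def)
qed

lemma set_play_round:
  assumes "half \<le> length ps"
  shows "set (play_round half wins ps) \<subseteq> set ps"
  using assms by (auto simp: play_round_def Let_def opponent_def)

lemma set_survivors:
  assumes "2 ^ (q - 1) < k" "k \<le> 2 ^ q" "l \<le> q"
  shows "set (survivors q k wins l) \<subseteq> {1..k}"
  using assms(3)
proof (induction l)
  case (Suc l)
  then show ?case
    using set_play_round[of "2 ^ (q - Suc l)" "survivors q k wins l" "wins l"]
      players_bounds[OF assms(1,2), of l] by (auto simp: length_survivors)
qed auto

lemma survivors_cong:
  assumes "\<And>l'. l' < l \<Longrightarrow> wins l' = wins' l'"
  shows "survivors q k wins l = survivors q k wins' l"
  using assms by (induction l) auto

text \<open>
  Only the match \<open>i\<close> of a best player matters: the round loses at most \<open>e\<close> if this match is won by a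
  player within \<open>e\<close> of its better participant. The index \<open>i\<close> depends on \<open>ps\<close> alone and is obtained
  before the outcomes \<open>wins\<close> are known, so that it can serve as a fixed choice in a probability bound.
\<close>

lemma Min_play_round_le:
  fixes f :: "'p \<Rightarrow> real"
  assumes half: "0 < half" "half \<le> length ps" "length ps \<le> 2 * half"
  obtains i where "i < half"
    "\<And>wins e. (let a = ps ! i; b = ps ! opponent half (length ps) i in
       f (if wins i a b then a else b) \<le> min (f a) (f b) + e) \<Longrightarrow>
       Min (f ` set (play_round half wins ps)) \<le> Min (f ` set ps) + e"
proof -
  have ne: "ps \<noteq> []" using half by auto
  then have "Min (f ` set ps) \<in> f ` set ps" by (intro Min_in) auto
  then obtain t where t: "t < length ps" "Min (f ` set ps) = f (ps ! t)"
    by (metis imageE in_set_conv_nth)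
  define i where "i = (if t < half then t else t - half)"
  have i: "i < half" using half t by (auto simp: i_def)
  have ti: "t = i \<or> t = opponent half (length ps) i"
    using t half by (auto simp: i_def opponent_def)
  have le: "Min (f ` set (play_round half wins ps)) \<le> Min (f ` set ps) + e"
    if "let a = ps ! i; b = ps ! opponent half (length ps) i in
       f (if wins i a b then a else b) \<le> min (f a) (f b) + e" for wins e
  proof -
    let ?a = "ps ! i" and ?b = "ps ! opponent half (length ps) i"
    have "Min (f ` set (play_round half wins ps)) \<le> f (if wins i ?a ?b then ?a else ?b)"
      using i by (intro Min_le) (auto simp: play_round_def Let_def)
    also have "\<dots> \<le> min (f ?a) (f ?b) + e"
      using that by (simp add: Let_def)
    also have "min (f ?a) (f ?b) \<le> f (ps ! t)"
      using ti by auto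
    finally show ?thesis using t by simp
  qed
  from that[OF i le] show thesis by blast
qed

lemma measurable_play_round:
  fixes ps :: "nat list"
  assumes [measurable]: "\<And>i a b. Measurable.pred N (\<lambda>z. wins z i a b)"
  shows "(\<lambda>z. play_round h (wins z) ps) \<in> measurable N (count_space UNIV)"
proof (rule measurableI)
  fix A :: "nat list set"
  have 1: "{z \<in> space N. play_round h (wins z) ps = ys} \<in> sets N" for ys
  proof -
    have "{z \<in> space N. play_round h (wins z) ps = ys} =
       {z \<in> space N. length ys = h \<and> (\<forall>i\<in>{..<h}. (if wins z i (ps ! i) (ps ! opponent h (length ps) i)
           then ps ! i else ps ! opponent h (length ps) i) = ys ! i)}"
      by (auto simp: play_round_def Let_def list_eq_iff_nth_eq)
    then show ?thesis by simp
  qed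
  have "(\<lambda>z. play_round h (wins z) ps) -` A \<inter> space N
    = (\<Union>ys\<in>A. {z \<in> space N. play_round h (wins z) ps = ys})" by auto
  also have "\<dots> \<in> sets N"
    using 1 by (intro sets.countable_UN') auto
  finally show "(\<lambda>z. play_round h (wins z) ps) -` A \<inter> space N \<in> sets N" .
qed auto

lemma measurable_survivors:
  assumes "\<And>l' i a b. l' < l \<Longrightarrow> Measurable.pred N (\<lambda>z. wins z l' i a b)"
  shows "(\<lambda>z. survivors q k (wins z) l) \<in> measurable N (count_space UNIV)"
  using assms
proof (induction l)
  case (Suc l)
  show ?case
    unfolding survivors.simps
  proof (rule measurable_compose_countable[where g = "\<lambda>z. survivors q k (wins z) l"])
    show "(\<lambda>z. play_round (2 ^ (q - Suc l)) (wins z l) ps) \<in> measurable N (count_space UNIV)" for ps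
      by (rule measurable_play_round) (simp add: Suc.prems)
  qed (use Suc in auto)
qed simp

text \<open>
  One match with failure probability \<open>p l\<close> is at stake in round \<open>l\<close>, namely the match of the best
  survivor. Which match this is depends on the earlier rounds only, so
  \<open>prob_independent_choice_le\<close> applies, and a union bound over the rounds gives the result.
\<close>

lemma (in prob_space) tournament:
  fixes wins :: "nat \<Rightarrow> nat \<Rightarrow> nat \<Rightarrow> nat \<Rightarrow> 'z \<Rightarrow> bool" and f :: "nat \<Rightarrow> real"
  assumes q: "2 ^ (q - 1) < k" "k \<le> 2 ^ q"
    and indep: "indep_vars (\<lambda>_. T) Z (UNIV :: nat set)"
    and meas: "\<And>l i a b. Measurable.pred T (wins l i a b)"
    and duel: "\<And>l i a b. l < q \<Longrightarrow> a \<in> {1..k} \<Longrightarrow> b \<in> {1..k} \<Longrightarrow>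
      prob {\<omega>\<in>space M. min (f a) (f b) + e l < f (if wins l i a b (Z l \<omega>) then a else b)} \<le> p l"
    and p: "\<And>l. l < q \<Longrightarrow> 0 \<le> p l"
  shows "prob {\<omega>\<in>space M. (MIN i\<in>{1..k}. f i) + (\<Sum>l<q. e l)
      < f (hd (survivors q k (\<lambda>l i a b. wins l i a b (Z l \<omega>)) q))} \<le> (\<Sum>l<q. p l)"
proof -
  note [measurable] = meas
  define S where "S l \<omega> = survivors q k (\<lambda>l i a b. wins l i a b (Z l \<omega>)) l" for l \<omega>
  have Z[measurable]: "random_variable T (Z l)" for l
    using indep by (auto simp: indep_vars_def)
  have Smeas[measurable]: "random_variable (count_space UNIV) (S l)" for l
    unfolding S_def by (rule measurable_survivors) simp
  define valid where "valid l ps \<longleftrightarrow> length ps = players q k l \<and> set ps \<subseteq> {1..k}" for l and ps :: "nat list"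
  define bad where "bad l ps z \<longleftrightarrow> valid l ps \<and> Min (f ` set ps) + e l <
      Min (f ` set (play_round (2 ^ (q - Suc l)) (\<lambda>i a b. wins l i a b z) ps))" for l ps z
  have bad_meas[measurable]: "Measurable.pred T (bad l ps)" for l ps
  proof -
    have [measurable]: "(\<lambda>z. play_round h (\<lambda>i a b. wins l i a b z) ps) \<in> measurable T (count_space UNIV)" for h ps
      by (rule measurable_play_round) simp
    show ?thesis unfolding bad_def by measurable
  qed
  have bad_prob: "prob {\<omega>\<in>space M. bad l (S l \<omega>) (Z l \<omega>)} \<le> p l" if l: "l < q" for l
  proof -
    let ?past = "\<lambda>\<omega>. \<lambda>i\<in>{..<l}. Z i \<omega>" and ?now = "\<lambda>\<omega>. \<lambda>i\<in>{l}. Z i \<omega>"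
    let ?S = "\<lambda>z. survivors q k (\<lambda>l i a b. wins l i a b (z l)) l"
    have iv: "indep_var (PiM {..<l} (\<lambda>_. T)) ?past (PiM {l} (\<lambda>_. T)) ?now"
      by (rule indep_var_restrict[OF indep]) auto
    have S_past: "?S (?past \<omega>) = S l \<omega>" for \<omega>
      by (auto simp: S_def intro!: survivors_cong)
    have "prob {\<omega>\<in>space M. bad l (?S (?past \<omega>)) (?now \<omega> l)} \<le> p l"
    proof (rule prob_independent_choice_le[OF iv])
      show "?S \<in> measurable (PiM {..<l} (\<lambda>_. T)) (count_space UNIV)"
        by (rule measurable_survivors) simp
      show "Measurable.pred (PiM {l} (\<lambda>_. T)) (\<lambda>z. bad l ps (z l))" for ps
        by simp
      fix ps
      have "prob {\<omega>\<in>space M. bad l ps (Z l \<omega>)} \<le> p l"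
      proof (cases "valid l ps")
        case True
        obtain i where i: "i < 2 ^ (q - Suc l)"
          "\<And>wins e. (let a = ps ! i; b = ps ! opponent (2 ^ (q - Suc l)) (length ps) i in
            f (if wins i a b then a else b) \<le> min (f a) (f b) + e) \<Longrightarrow>
            Min (f ` set (play_round (2 ^ (q - Suc l)) wins ps)) \<le> Min (f ` set ps) + e"
          using Min_play_round_le[of "2 ^ (q - Suc l)" ps f] True players_bounds[OF q l]
          unfolding valid_def by (metis zero_less_numeral zero_less_power)
        let ?a = "ps ! i" and ?b = "ps ! opponent (2 ^ (q - Suc l)) (length ps) i"
        have lt: "i < length ps" "opponent (2 ^ (q - Suc l)) (length ps) i < length ps"
          using i(1) True players_bounds[OF q l] by (auto simp: valid_def opponent_def)
        have ab: "?a \<in> {1..k}" "?b \<in> {1..k}"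
          using True lt nth_mem unfolding valid_def by blast+
        have "prob {\<omega>\<in>space M. bad l ps (Z l \<omega>)}
          \<le> prob {\<omega>\<in>space M. min (f ?a) (f ?b) + e l < f (if wins l i ?a ?b (Z l \<omega>) then ?a else ?b)}"
        proof (rule finite_measure_mono)
          show "{\<omega>\<in>space M. bad l ps (Z l \<omega>)}
          \<subseteq> {\<omega>\<in>space M. min (f ?a) (f ?b) + e l < f (if wins l i ?a ?b (Z l \<omega>) then ?a else ?b)}"
            using i(2)[of "\<lambda>i a b. wins l i a b (Z l _)" "e l"]
            unfolding bad_def Let_def by (force simp: not_le[symmetric] simp del: not_le)
        qed measurable
        then show ?thesis using duel[OF l ab, of i] by simp
      qed (simp add: bad_def p l)
      then show "prob {\<omega>\<in>space M. bad l ps (?now \<omega> l)} \<le> p l" by simp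
    qed
    then show ?thesis unfolding S_past by simp
  qed
  have good: "Min (f ` set (S l \<omega>)) \<le> (MIN i\<in>{1..k}. f i) + (\<Sum>l<l. e l)"
    if "l \<le> q" "\<And>l'. l' < l \<Longrightarrow> \<not> bad l' (S l' \<omega>) (Z l' \<omega>)" for l \<omega>
    using that
  proof (induction l)
    case 0
    have "set (S 0 \<omega>) = {1..k}" by (auto simp: S_def)
    then show ?case by simp
  next
    case (Suc l)
    have "valid l (S l \<omega>)"
      using Suc.prems set_survivors[OF q, of l] by (auto simp: valid_def S_def length_survivors)
    then have "Min (f ` set (S (Suc l) \<omega>)) \<le> Min (f ` set (S l \<omega>)) + e l"
      using Suc.prems(2)[of l] by (auto simp: bad_def S_def not_less)
    then show ?case using Suc by force
  qed
  have "length (S q \<omega>) = 1" for \<omega>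
    using q by (auto simp: S_def length_survivors players_def)
  then have last: "f (hd (S q \<omega>)) = Min (f ` set (S q \<omega>))" for \<omega>
    by (metis (no_types, lifting) One_nat_def Min_singleton image_empty image_insert length_0_conv
        length_Suc_conv list.sel(1) list.set(1) list.simps(15))
  have "prob {\<omega>\<in>space M. (MIN i\<in>{1..k}. f i) + (\<Sum>l<q. e l) < f (hd (S q \<omega>))}
     \<le> prob (\<Union>l<q. {\<omega>\<in>space M. bad l (S l \<omega>) (Z l \<omega>)})"
  proof (rule finite_measure_mono)
    show "{\<omega>\<in>space M. (MIN i\<in>{1..k}. f i) + (\<Sum>l<q. e l) < f (hd (S q \<omega>))}
      \<subseteq> (\<Union>l<q. {\<omega>\<in>space M. bad l (S l \<omega>) (Z l \<omega>)})"
      using good[of q] unfolding last by (force simp: not_le[symmetric] simp del: not_le)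
    have [measurable]: "Measurable.pred M (\<lambda>\<omega>. bad l (S l \<omega>) (Z l \<omega>))" for l
      by (rule measurable_compose_countable[where g = "S l"]) auto
    show "(\<Union>l<q. {\<omega>\<in>space M. bad l (S l \<omega>) (Z l \<omega>)}) \<in> events" by measurable
  qed
  also have "\<dots> \<le> (\<Sum>l<q. prob {\<omega>\<in>space M. bad l (S l \<omega>) (Z l \<omega>)})"
  proof (rule finite_measure_subadditive_finite)
    have [measurable]: "Measurable.pred M (\<lambda>\<omega>. bad l (S l \<omega>) (Z l \<omega>))" for l
      by (rule measurable_compose_countable[where g = "S l"]) auto
    show "(\<lambda>l. {\<omega>\<in>space M. bad l (S l \<omega>) (Z l \<omega>)}) ` {..<q} \<subseteq> events" by auto
  qed simp
  also have "\<dots> \<le> (\<Sum>l<q. p l)"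
    by (intro sum_mono bad_prob) simp
  finally show ?thesis by (simp add: S_def)
qed


section \<open>Deciding a duel by sampling gradients on a segment\<close>

definition slope ::
  "(real ^ 'n \<Rightarrow> 'w \<Rightarrow> real ^ 'n) \<Rightarrow> real ^ 'n \<Rightarrow> real ^ 'n \<Rightarrow> real \<times> 'w \<Rightarrow> real" where
  "slope g1 A B = (\<lambda>(u, w). g1 (B + u *\<^sub>R (A - B)) w \<bullet> (A - B))"

definition gap_estimate ::
  "(real ^ 'n \<Rightarrow> 'w \<Rightarrow> real ^ 'n) \<Rightarrow> (real ^ 'n \<Rightarrow> real) \<Rightarrow> nat \<Rightarrow> real ^ 'n \<Rightarrow> real ^ 'n \<Rightarrow>
   (nat \<Rightarrow> real \<times> 'w) \<Rightarrow> real" where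
  "gap_estimate g1 h2 N A B z = h2 A - h2 B + (\<Sum>n<N. slope g1 A B (z n)) / real N"

text \<open>
  Batch \<open>j\<close> votes for \<open>A\<close> if it estimates \<open>h A - h B\<close> to be at most \<open>0\<close>. A tie goes to \<open>A\<close>.
\<close>

definition prefers ::
  "(real ^ 'n \<Rightarrow> 'w \<Rightarrow> real ^ 'n) \<Rightarrow> (real ^ 'n \<Rightarrow> real) \<Rightarrow> nat \<Rightarrow> nat \<Rightarrow> real ^ 'n \<Rightarrow> real ^ 'n \<Rightarrow>
   (nat \<Rightarrow> nat \<Rightarrow> real \<times> 'w) \<Rightarrow> bool" where
  "prefers g1 h2 m N A B z \<longleftrightarrow>
     0 \<le> (\<Sum>j<m. if gap_estimate g1 h2 N A B (z j) \<le> 0 then 1 else - 1 :: real)"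

abbreviation coin :: "'w measure \<Rightarrow> (real \<times> 'w) measure" where
  "coin W \<equiv> uniform_measure lborel {0..1} \<Otimes>\<^sub>M W"

lemma prob_space_uniform01: "prob_space (uniform_measure lborel {0..1::real})"
  by (rule prob_space_uniform_measure) auto

lemma prob_space_coin:
  assumes "prob_space W"
  shows "prob_space (coin W)"
proof -
  interpret U: prob_space "uniform_measure lborel {0..1::real}" by (rule prob_space_uniform01)
  interpret W: prob_space W by fact
  interpret pair_prob_space "uniform_measure lborel {0..1::real}" W ..
  show ?thesis by unfold_locales
qed

lemma measurable_slope:
  assumes "(\<lambda>(y, w). g1 y w) \<in> borel_measurable (borel \<Otimes>\<^sub>M W)"
  shows "slope g1 A B \<in> borel_measurable (coin W)"
proof -
  have "(\<lambda>p. (B + fst p *\<^sub>R (A - B), snd p)) \<in> measurable (coin W) (borel \<Otimes>\<^sub>M W)"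
    by (intro measurable_Pair) measurable
  from measurable_compose[OF this assms]
  have [measurable]: "(\<lambda>p. g1 (B + fst p *\<^sub>R (A - B)) (snd p)) \<in> borel_measurable (coin W)"
    by simp
  show ?thesis unfolding slope_def split_beta by measurable
qed

lemma uniform01_density:
  "uniform_measure lborel {0..1::real} = density lborel (\<lambda>x. ennreal (indicator {0..1} x))"
  unfolding uniform_measure_def by (rule density_cong) (auto simp: indicator_def)

lemma integral_uniform01:
  fixes f :: "real \<Rightarrow> real"
  assumes "f \<in> borel_measurable lborel"
  shows "(\<integral>x. f x \<partial>uniform_measure lborel {0..1}) = (LINT x:{0..1}|lborel. f x)"
  using assms by (simp add: uniform01_density integral_density set_lebesgue_integral_def)

text \<open>
  The mean is the fundamental theorem of calculus for \<open>h1\<close> on the segment from \<open>B\<close> to \<open>A\<close>. The version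
  for the Henstock-Kurzweil integral is used because the gradient is not assumed to be continuous;
  the second moment bound makes it Lebesgue integrable as well. The convex set \<open>K\<close> keeps the query
  points where the assumptions on the oracle hold.
\<close>

lemma slope_moments:
  fixes g1 :: "real ^ 'n \<Rightarrow> 'w \<Rightarrow> real ^ 'n"
  assumes W: "prob_space W"
    and g1: "(\<lambda>(y, w). g1 y w) \<in> borel_measurable (borel \<Otimes>\<^sub>M W)"
    and K: "convex K" "A \<in> K" "B \<in> K"
    and grad: "\<And>y. y \<in> K \<Longrightarrow> GDERIV h1 y :> (\<integral>w. g1 y w \<partial>W)"
    and sq: "\<And>y. y \<in> K \<Longrightarrow> integrable W (\<lambda>w. (norm (g1 y w))\<^sup>2)"
    and bound: "\<And>y. y \<in> K \<Longrightarrow> (\<integral>w. (norm (g1 y w))\<^sup>2 \<partial>W) \<le> L\<^sup>2"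
    and R: "norm (A - B) \<le> R"
  shows "integrable (coin W) (\<lambda>z. (slope g1 A B z)\<^sup>2)"
    and "(\<integral>z. (slope g1 A B z)\<^sup>2 \<partial>coin W) \<le> L\<^sup>2 * R\<^sup>2"
    and "(\<integral>z. slope g1 A B z \<partial>coin W) = h1 A - h1 B"
proof -
  let ?U = "uniform_measure lborel {0..1::real}"
  interpret U: prob_space ?U by (rule prob_space_uniform01)
  interpret W: prob_space W by fact
  interpret UW: pair_prob_space ?U W ..
  note meas[measurable] = measurable_slope[OF g1, of A B]
  define y where "y u = B + u *\<^sub>R (A - B)" for u
  have yK: "y u \<in> K" if "u \<in> {0..1}" for u
  proof -
    have "y u = (1 - u) *\<^sub>R B + u *\<^sub>R A" by (simp add: y_def algebra_simps)
    then show ?thesis using that K by (simp add: convexD_alt)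
  qed
  have g1y[measurable]: "g1 x \<in> borel_measurable W" for x
    using measurable_compose[OF measurable_Pair1' g1, of x] by simp
  \<comment> \<open>outside of \<open>[0,1]\<close> the query point may leave \<open>K\<close>, and nothing is known there\<close>
  have AE01: "AE u in ?U. u \<in> {0..1}"
    by (rule AE_uniform_measureI) auto
  have nn: "(\<integral>\<^sup>+ z. ennreal ((slope g1 A B z)\<^sup>2) \<partial>coin W) \<le> ennreal (L\<^sup>2 * R\<^sup>2)"
  proof -
    have "(\<integral>\<^sup>+ z. ennreal ((slope g1 A B z)\<^sup>2) \<partial>coin W)
        = (\<integral>\<^sup>+ u. \<integral>\<^sup>+ w. ennreal ((slope g1 A B (u, w))\<^sup>2) \<partial>W \<partial>?U)"
      by (rule W.nn_integral_fst[symmetric]) measurable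
    also have "\<dots> \<le> (\<integral>\<^sup>+ u. ennreal (L\<^sup>2 * R\<^sup>2) \<partial>?U)"
    proof (rule nn_integral_mono_AE)
      show "AE u in ?U. (\<integral>\<^sup>+ w. ennreal ((slope g1 A B (u, w))\<^sup>2) \<partial>W) \<le> ennreal (L\<^sup>2 * R\<^sup>2)"
        using AE01
      proof eventually_elim
        case (elim u)
        have "(\<integral>\<^sup>+ w. ennreal ((slope g1 A B (u, w))\<^sup>2) \<partial>W)
            \<le> (\<integral>\<^sup>+ w. ennreal ((norm (g1 (y u) w))\<^sup>2 * R\<^sup>2) \<partial>W)"
        proof (rule nn_integral_mono, rule ennreal_leI)
          fix w
          have "\<bar>slope g1 A B (u, w)\<bar> \<le> norm (g1 (y u) w) * norm (A - B)"
            unfolding slope_def y_def by (simp add: Cauchy_Schwarz_ineq2)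
          also have "\<dots> \<le> norm (g1 (y u) w) * R"
            using R by (simp add: mult_left_mono)
          finally have "\<bar>slope g1 A B (u, w)\<bar>\<^sup>2 \<le> (norm (g1 (y u) w) * R)\<^sup>2"
            by (rule power_mono) simp
          then show "(slope g1 A B (u, w))\<^sup>2 \<le> (norm (g1 (y u) w))\<^sup>2 * R\<^sup>2"
            by (simp add: power_mult_distrib)
        qed
        also have "\<dots> = ennreal (\<integral>w. (norm (g1 (y u) w))\<^sup>2 * R\<^sup>2 \<partial>W)"
          using sq[OF yK[OF elim]] by (intro nn_integral_eq_integral) auto
        also have "\<dots> \<le> ennreal (L\<^sup>2 * R\<^sup>2)"
          using bound[OF yK[OF elim]] by (intro ennreal_leI) (simp add: mult_right_mono)
        finally show ?case .
      qed
    qed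
    also have "\<dots> = ennreal (L\<^sup>2 * R\<^sup>2)"
      using U.emeasure_space_1 by simp
    finally show ?thesis .
  qed
  show int2: "integrable (coin W) (\<lambda>z. (slope g1 A B z)\<^sup>2)"
    using nn by (intro integrableI_nonneg) (auto intro: le_less_trans)
  have "ennreal (\<integral>z. (slope g1 A B z)\<^sup>2 \<partial>coin W) \<le> ennreal (L\<^sup>2 * R\<^sup>2)"
    using nn nn_integral_eq_integral[OF int2] by simp
  then show "(\<integral>z. (slope g1 A B z)\<^sup>2 \<partial>coin W) \<le> L\<^sup>2 * R\<^sup>2"
    by (simp add: ennreal_le_iff)
  have int: "integrable (coin W) (slope g1 A B)"
    by (rule UW.P.square_integrable_imp_integrable[OF meas int2])
  define d where "d u = (\<integral>w. slope g1 A B (u, w) \<partial>W)" for u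
  have d_int: "integrable ?U d"
    using UW.integrable_fst'[OF int] by (simp add: d_def[abs_def])
  then have d_meas[measurable]: "d \<in> borel_measurable borel"
    using measurable_cong_sets[of ?U borel borel borel] borel_measurable_integrable by auto
  have d_eq: "d u = (\<integral>w. g1 (y u) w \<partial>W) \<bullet> (A - B)" if "u \<in> {0..1}" for u
  proof -
    have "integrable W (g1 (y u))"
      using W.square_integrable_imp_integrable[of "\<lambda>w. norm (g1 (y u) w)"] sq[OF yK[OF that]]
      by (simp add: integrable_norm_iff)
    then show ?thesis unfolding d_def slope_def y_def by simp
  qed
  have deriv: "((\<lambda>u. h1 (y u)) has_vector_derivative d u) (at u within {0..1})" if "u \<in> {0..1}" for u
  proof -
    have 1: "(y has_derivative (\<lambda>t. t *\<^sub>R (A - B))) (at u)"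
      unfolding y_def by (auto intro!: derivative_eq_intros)
    have "(h1 has_derivative (\<lambda>v. v \<bullet> (\<integral>w. g1 (y u) w \<partial>W))) (at (y u))"
      using grad[OF yK[OF that]] by (simp add: gderiv_def)
    from has_derivative_compose[OF 1 this]
    have "((\<lambda>u. h1 (y u)) has_derivative (\<lambda>t. t *\<^sub>R d u)) (at u)"
      by (simp add: d_eq[OF that] inner_commute)
    then show ?thesis
      unfolding has_vector_derivative_def by (rule has_derivative_at_withinI)
  qed
  have ftc: "(d has_integral (h1 (y 1) - h1 (y 0))) {0..1}"
    using fundamental_theorem_of_calculus[of 0 1 "\<lambda>u. h1 (y u)" d] deriv by simp
  have dset: "set_integrable lborel {0..1} d"
    using d_int by (simp add: uniform01_density integrable_density set_integrable_def)
  have "(\<integral>z. slope g1 A B z \<partial>coin W) = (\<integral>u. d u \<partial>?U)"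
    unfolding d_def by (rule UW.integral_fst'[OF int, symmetric])
  also have "\<dots> = integral {0..1} d"
    using set_borel_integral_eq_integral(2)[OF dset] by (simp add: integral_uniform01)
  also have "\<dots> = h1 (y 1) - h1 (y 0)"
    using ftc by (rule integral_unique)
  finally show "(\<integral>z. slope g1 A B z \<partial>coin W) = h1 A - h1 B"
    by (simp add: y_def)
qed

lemma (in prob_space) abs_expectation_le:
  fixes f :: "'a \<Rightarrow> real"
  assumes "f \<in> borel_measurable M" and "integrable M (\<lambda>x. (f x)\<^sup>2)"
    and "expectation (\<lambda>x. (f x)\<^sup>2) \<le> c\<^sup>2" and "0 \<le> c"
  shows "\<bar>expectation f\<bar> \<le> c"
proof -
  have "0 \<le> variance f" by (rule variance_positive)
  then have "(expectation f)\<^sup>2 \<le> c\<^sup>2"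
    using assms(3) variance_eq[OF square_integrable_imp_integrable[OF assms(1,2)] assms(2)] by linarith
  then show ?thesis
    using \<open>0 \<le> c\<close> by (metis abs_le_square_iff abs_of_nonneg)
qed

lemma (in prob_space) indep_vars_reindex:
  assumes "indep_vars (\<lambda>_. S) X UNIV" and "inj f"
  shows "indep_vars (\<lambda>_. S) (\<lambda>j. X (f j)) UNIV"
proof -
  have "indep_vars (\<lambda>j. PiM {f j} (\<lambda>_. S)) (\<lambda>j \<omega>. restrict (\<lambda>i. X i \<omega>) {f j}) UNIV"
    using assms by (intro indep_vars_restrict) (auto simp: disjoint_family_on_def inj_def)
  from indep_vars_compose2[OF this, of "\<lambda>j v. v (f j)" "\<lambda>_. S"]
  show ?thesis by simp
qed

lemma (in prob_space) indep_vars_curry: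
  fixes X :: "'i \<times> 'j \<Rightarrow> 'a \<Rightarrow> 'b"
  assumes "indep_vars (\<lambda>_. S) X UNIV"
  shows "indep_vars (\<lambda>_. PiM UNIV (\<lambda>_. S)) (\<lambda>i \<omega> j. X (i, j) \<omega>) UNIV"
proof -
  have "indep_vars (\<lambda>i. PiM ({i} \<times> UNIV) (\<lambda>_. S)) (\<lambda>i \<omega>. restrict (\<lambda>p. X p \<omega>) ({i} \<times> UNIV)) UNIV"
    using assms by (intro indep_vars_restrict) (auto simp: disjoint_family_on_def)
  then have "indep_vars (\<lambda>_. PiM UNIV (\<lambda>_. S))
      (\<lambda>i \<omega>. (\<lambda>v j. v (i, j)) (restrict (\<lambda>p. X p \<omega>) ({i} \<times> UNIV))) UNIV"
    by (rule indep_vars_compose2) (auto intro!: measurable_PiM_single' simp: space_PiM PiE_iff)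
  then show ?thesis by simp
qed

lemma measurable_gap_estimate:
  assumes "(\<lambda>(y, w). g1 y w) \<in> borel_measurable (borel \<Otimes>\<^sub>M W)"
  shows "gap_estimate g1 h2 N A B \<in> borel_measurable (PiM UNIV (\<lambda>_. coin W))"
proof -
  note [measurable] = measurable_slope[OF assms]
  show ?thesis unfolding gap_estimate_def by measurable
qed

lemma measurable_prefers:
  assumes "(\<lambda>(y, w). g1 y w) \<in> borel_measurable (borel \<Otimes>\<^sub>M W)"
  shows "Measurable.pred (PiM UNIV (\<lambda>_. PiM UNIV (\<lambda>_. coin W))) (prefers g1 h2 m N A B)"
proof -
  note [measurable] = measurable_gap_estimate[OF assms]
  show ?thesis unfolding prefers_def by measurable
qed

lemma sum_votes:
  "(\<Sum>j<m. if P j then 1 else - 1 :: real) = real m - 2 * real (card {j. j < m \<and> \<not> P j})"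
proof -
  have "(\<Sum>j<m. if P j then 1 else - 1 :: real) = (\<Sum>j<m. 1 - 2 * (if \<not> P j then 1 else 0))"
    by (rule sum.cong) auto
  also have "\<dots> = real m - 2 * (\<Sum>j<m. if \<not> P j then 1 else 0)"
    by (simp only: sum_subtractf sum_distrib_left) simp
  also have "(\<Sum>j<m. if \<not> P j then 1 else 0 :: real) = real (card {j \<in> {..<m}. \<not> P j})"
    by (subst sum.inter_filter[symmetric]) simp_all
  finally show ?thesis by simp
qed

text \<open>
  If \<open>h A\<close> and \<open>h B\<close> differ by at most \<open>e\<close>, either winner is acceptable. Otherwise every batch that
  votes for the wrong point is off by at least \<open>e\<close>, and the wrong point wins only if at least half of
  the batches do so.
\<close>

lemma (in prob_space) duel_error:
  fixes g1 :: "real ^ 'n \<Rightarrow> 'w \<Rightarrow> real ^ 'n" and X :: "nat \<times> nat \<Rightarrow> 'a \<Rightarrow> real \<times> 'w"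
  assumes indep: "indep_vars (\<lambda>_. coin W) X UNIV"
    and distr: "\<And>p. distr M (coin W) (X p) = coin W"
    and g1: "(\<lambda>(y, w). g1 y w) \<in> borel_measurable (borel \<Otimes>\<^sub>M W)"
    and sq: "integrable (coin W) (\<lambda>z. (slope g1 A B z)\<^sup>2)"
    and second: "(\<integral>z. (slope g1 A B z)\<^sup>2 \<partial>coin W) \<le> s"
    and mean: "(\<integral>z. slope g1 A B z \<partial>coin W) = h1 A - h1 B"
    and h: "\<And>y. h y = h1 y + h2 y"
    and N: "N > 0" "16 * s \<le> real N * e\<^sup>2" and e: "e > 0" and m: "m > 0"
  shows "prob {\<omega>\<in>space M. min (h A) (h B) + e <
      h (if prefers g1 h2 m N A B (\<lambda>j n. X (j, n) \<omega>) then A else B)} \<le> (1 / 2) ^ m"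
proof -
  note [measurable] = measurable_slope[OF g1]
  have X[measurable]: "random_variable (coin W) (X p)" for p
    using indep by (simp only: indep_vars_def) blast
  define G where "G j \<omega> = gap_estimate g1 h2 N A B (\<lambda>n. X (j, n) \<omega>)" for j \<omega>
  define D where "D j \<omega> \<longleftrightarrow> e \<le> \<bar>G j \<omega> - (h A - h B)\<bar>" for j \<omega>
  have G: "indep_vars (\<lambda>_. borel) G UNIV"
    unfolding G_def
    by (rule indep_vars_compose2[OF indep_vars_curry[OF indep]]) (rule measurable_gap_estimate[OF g1])
  then have [measurable]: "random_variable borel (G j)" for j
    by (auto simp: indep_vars_def)
  have "indep_vars (\<lambda>_. count_space UNIV) D UNIV"
    unfolding D_def by (rule indep_vars_compose2[OF G]) measurable
  then have D: "indep_vars (\<lambda>_. count_space UNIV) D {..<m}"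
    by (rule indep_vars_subset) simp
  have Dprob: "prob {\<omega>\<in>space M. D j \<omega>} \<le> 1 / 16" for j
  proof -
    let ?Y = "\<lambda>n \<omega>. slope g1 A B (X (j, n) \<omega>)"
    have iY: "indep_vars (\<lambda>_. borel) ?Y {..<N}"
      by (rule indep_vars_subset[OF indep_vars_compose2[OF indep_vars_reindex[OF indep, of "Pair j"]]])
        (auto simp: inj_def)
    have tr: "integrable M (\<lambda>\<omega>. f (X p \<omega>)) = integrable (coin W) f"
        "expectation (\<lambda>\<omega>. f (X p \<omega>)) = (\<integral>z. f z \<partial>coin W)"
      if "f \<in> borel_measurable (coin W)" for f :: "_ \<Rightarrow> real" and p
      using that distr[of p] integrable_distr_eq[OF X that, of p] integral_distr[OF X that, of p]
      by auto
    have "prob {\<omega>\<in>space M. D j \<omega>}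
       = prob {\<omega>\<in>space M. e \<le> \<bar>(\<Sum>n<N. ?Y n \<omega>) / real N - (h1 A - h1 B)\<bar>}"
      by (simp add: D_def G_def gap_estimate_def h algebra_simps)
    also have "\<dots> \<le> s / (real N * e\<^sup>2)"
      using iY N(1) e sq second mean tr(1)[of "\<lambda>z. (slope g1 A B z)\<^sup>2"]
        tr(2)[of "\<lambda>z. (slope g1 A B z)\<^sup>2"] tr(2)[of "slope g1 A B"]
      by (intro mean_of_samples_deviation) simp_all
    also have "\<dots> \<le> 1 / 16"
      using N e by (simp add: divide_le_eq)
    finally show ?thesis .
  qed
  have sub: "m \<le> 2 * card {j. j < m \<and> D j \<omega>}"
    if "min (h A) (h B) + e < h (if prefers g1 h2 m N A B (\<lambda>j n. X (j, n) \<omega>) then A else B)" for \<omega>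
  proof -
    let ?neg = "{j. j < m \<and> \<not> G j \<omega> \<le> 0}" and ?pos = "{j. j < m \<and> G j \<omega> \<le> 0}"
    have pref: "prefers g1 h2 m N A B (\<lambda>j n. X (j, n) \<omega>) \<longleftrightarrow> 2 * card ?neg \<le> m"
      unfolding prefers_def sum_votes G_def by (simp add: algebra_simps) linarith
    have "?neg \<union> ?pos = {..<m}" by auto
    then have "card ?neg + card ?pos = card {..<m}"
      by (subst card_Un_disjoint[symmetric]) auto
    then have tot: "card ?neg + card ?pos = m" by simp
    show ?thesis
    proof (cases "prefers g1 h2 m N A B (\<lambda>j n. X (j, n) \<omega>)")
      case True
      then have "e < h A - h B" using that e by (auto simp: min_def split: if_splits)
      then have "?pos \<subseteq> {j. j < m \<and> D j \<omega>}" by (auto simp: D_def)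
      then have "card ?pos \<le> card {j. j < m \<and> D j \<omega>}" by (intro card_mono) auto
      then show ?thesis using True pref tot by simp
    next
      case False
      then have "e < h B - h A" using that e by (auto simp: min_def split: if_splits)
      then have "?neg \<subseteq> {j. j < m \<and> D j \<omega>}" by (auto simp: D_def)
      then have "card ?neg \<le> card {j. j < m \<and> D j \<omega>}" by (intro card_mono) auto
      then show ?thesis using False pref tot by simp
    qed
  qed
  have [measurable]: "Measurable.pred M (D j)" for j
    unfolding D_def by measurable
  have "prob {\<omega>\<in>space M. min (h A) (h B) + e <
      h (if prefers g1 h2 m N A B (\<lambda>j n. X (j, n) \<omega>) then A else B)}
    \<le> prob {\<omega>\<in>space M. m \<le> 2 * card {j. j < m \<and> D j \<omega>}}"
    by (rule finite_measure_mono) (use sub in auto)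
  also have "\<dots> \<le> (1 / 2) ^ m"
    by (rule majority_fails[OF D Dprob])
  finally show ?thesis .
qed

section \<open>Samples drawn from the coins of a program\<close>

lemma indep_vars_PiM_components:
  assumes "\<And>i. i \<in> I \<Longrightarrow> prob_space (N i)" and "I \<noteq> {}"
  shows "prob_space.indep_vars (PiM I N) N (\<lambda>i \<omega>. \<omega> i) I"
proof -
  interpret P: prob_space "PiM I N" by (rule prob_space_PiM) (use assms in auto)
  have "distr (PiM I N) (PiM I N) (\<lambda>\<omega>. \<lambda>i\<in>I. \<omega> i) = distr (PiM I N) (PiM I N) (\<lambda>\<omega>. \<omega>)"
    by (rule distr_cong) (auto simp: space_PiM PiE_restrict)
  also have "\<dots> = PiM I (\<lambda>i. distr (PiM I N) (N i) (\<lambda>\<omega>. \<omega> i))"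
    using assms by (auto intro!: PiM_cong simp: distr_PiM_component)
  finally show ?thesis
    using assms by (subst P.indep_vars_iff_distr_eq_PiM') auto
qed

text \<open>
  A sample of the program takes its uniform number from one coordinate of \<open>coins\<close> and its oracle seed
  from another one, since a round either computes or queries. As long as no coordinate is used by two
  samples, this is as good as drawing independent pairs.
\<close>

lemma sampled_coins:
  fixes p q :: "'i \<Rightarrow> nat \<times> nat"
  assumes W: "prob_space W" and pq: "inj p" "inj q" "range p \<inter> range q = {}"
  defines "X \<equiv> \<lambda>i \<omega>. (fst (\<omega> (p i)), snd (\<omega> (q i)))"
  shows "prob_space.indep_vars (coins W) (\<lambda>_. coin W) X UNIV"
    and "distr (coins W) (coin W) (X i) = coin W"
proof -
  interpret U: prob_space "uniform_measure lborel {0..1::real}" by (rule prob_space_uniform01)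
  interpret W: prob_space W by fact
  interpret C: prob_space "coin W" by (rule prob_space_coin) fact
  interpret P: prob_space "coins W"
    unfolding coins_def by (rule prob_space_PiM) (rule C.prob_space_axioms)
  have ind: "P.indep_vars (\<lambda>_. coin W) (\<lambda>c \<omega>. \<omega> c) UNIV"
    using indep_vars_PiM_components[of UNIV "\<lambda>_ :: nat \<times> nat. coin W"] C.prob_space_axioms
    by (simp add: coins_def)
  have "P.indep_vars (\<lambda>i. PiM {p i, q i} (\<lambda>_. coin W)) (\<lambda>i \<omega>. restrict (\<lambda>c. \<omega> c) {p i, q i}) UNIV"
  proof (rule P.indep_vars_restrict[OF ind])
    have "p i \<noteq> q j" for i j
      using pq(3) by auto
    then show "disjoint_family_on (\<lambda>i. {p i, q i}) UNIV"
      using pq(1,2) by (auto simp: disjoint_family_on_def inj_def)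
  qed simp
  then have "P.indep_vars (\<lambda>_. coin W)
      (\<lambda>i \<omega>. (\<lambda>v. (fst (v (p i)), snd (v (q i)))) (restrict (\<lambda>c. \<omega> c) {p i, q i})) UNIV"
    by (rule P.indep_vars_compose2) measurable
  then show "P.indep_vars (\<lambda>_. coin W) X UNIV"
    by (simp add: X_def)
  have "P.indep_var (PiM {p i} (\<lambda>_. coin W)) (\<lambda>\<omega>. restrict (\<lambda>c. \<omega> c) {p i})
      (PiM {q i} (\<lambda>_. coin W)) (\<lambda>\<omega>. restrict (\<lambda>c. \<omega> c) {q i})"
    by (rule P.indep_var_restrict[OF ind]) (use pq in auto)
  from P.indep_var_compose[OF this, of "\<lambda>v. v (p i)" "coin W" "\<lambda>v. v (q i)" "coin W"]
  have iv: "P.indep_var (coin W) (\<lambda>\<omega>. \<omega> (p i)) (coin W) (\<lambda>\<omega>. \<omega> (q i))"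
    by (simp add: comp_def)
  have comp: "distr (coins W) (coin W) (\<lambda>\<omega>. \<omega> c) = coin W" for c
    unfolding coins_def by (rule distr_PiM_component) (auto intro: C.prob_space_axioms)
  have [measurable]: "(\<lambda>\<omega>. \<omega> c) \<in> measurable (coins W) (coin W)" for c
    unfolding coins_def by measurable
  have "distr (coins W) (coin W) (X i)
      = distr (distr (coins W) (coin W \<Otimes>\<^sub>M coin W) (\<lambda>\<omega>. (\<omega> (p i), \<omega> (q i)))) (coin W)
          (\<lambda>(a, b). (fst a, snd b))"
    by (subst distr_distr) (auto simp: X_def comp_def)
  also have "distr (coins W) (coin W \<Otimes>\<^sub>M coin W) (\<lambda>\<omega>. (\<omega> (p i), \<omega> (q i))) = coin W \<Otimes>\<^sub>M coin W"
    using iv by (simp add: P.indep_var_distribution_eq comp)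
  also have "distr (coin W \<Otimes>\<^sub>M coin W) (coin W) (\<lambda>(a, b). (fst a, snd b))
      = distr (coin W) (uniform_measure lborel {0..1}) fst \<Otimes>\<^sub>M distr (coin W) W snd"
  proof (rule pair_measure_distr[symmetric])
    show "sigma_finite_measure (distr (coin W) W snd)"
      by (intro prob_space_imp_sigma_finite C.prob_space_distr) simp
  qed auto
  also have "\<dots> = coin W"
  proof -
    interpret S: pair_prob_space "uniform_measure lborel {0..1::real}" W ..
    have "distr (coin W) (uniform_measure lborel {0..1}) fst = uniform_measure lborel {0..1::real}"
      by (rule W.distr_pair_fst)
    moreover have "distr (coin W) W snd = W"
      proof (rule measure_eqI)
      fix A assume "A \<in> sets (distr (coin W) W snd)"
      then have A: "A \<in> sets W" by simp
      have "emeasure (distr (coin W) W snd) A = emeasure (coin W) (space lborel \<times> A)"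
        using A by (subst emeasure_distr) (auto intro!: arg_cong[where f = "emeasure (coin W)"]
            simp: space_pair_measure dest: sets.sets_into_space)
      also have "\<dots> = emeasure W A"
        using A U.emeasure_space_1 by (subst W.emeasure_pair_measure_Times) auto
      finally show "emeasure (distr (coin W) W snd) A = emeasure W A" .
    qed simp
    ultimately show ?thesis by simp
  qed
  finally show "distr (coins W) (coin W) (X i) = coin W" .
qed


section \<open>The program\<close>

text \<open>
  The registers beside the slots of the points, by purpose. A register \<open>Sample i j n\<close>, \<open>n\<close> being the
  position in batch \<open>j\<close> of match \<open>i\<close>, exists as a scalar and as a vector; the scalar is first the
  random position on the segment and then the sampled slope, the vector is the query point and then
  the answer. In \<open>Batch i j\<close> the estimate is overwritten by the vote.
\<close>

datatype cell =
    One | MinusOne | Zero | Weight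
  | Diff nat | Sample nat nat nat | Batch nat nat | Tally nat

instance cell :: countable
  by countable_datatype

text \<open>
  Slot \<open>i < k\<close> is register \<open>Suc i\<close>, because the input occupies the registers \<open>1\<close> to \<open>k\<close>. The other cells
  lie above.
\<close>

definition reg :: "nat \<Rightarrow> cell \<Rightarrow> nat" where
  "reg k c = Suc (k + to_nat c)"

lemma reg_eq_iff [simp]: "reg k c = reg k c' \<longleftrightarrow> c = c'"
  by (simp add: reg_def)

lemma slot_neq_reg [simp]: "i < k \<Longrightarrow> Suc i \<noteq> reg k c" "i < k \<Longrightarrow> reg k c \<noteq> Suc i"
  by (simp_all add: reg_def)

definition table :: "nat \<Rightarrow> ('x \<Rightarrow> cell) \<Rightarrow> ('x \<Rightarrow> 'y) \<Rightarrow> 'x list \<Rightarrow> (nat \<times> 'y) list" where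
  "table k c f xs = map (\<lambda>x. (reg k (c x), f x)) xs"

lemma map_of_table_slot [simp]: "i < k \<Longrightarrow> map_of (table k c f xs) (Suc i) = None"
  by (auto simp: table_def map_of_eq_None_iff)

lemma map_of_table_reg:
  assumes "inj c"
  shows "map_of (table k c f xs) (reg k (c x)) = (if x \<in> set xs then Some (f x) else None)"
  using assms by (induction xs) (auto simp: table_def inj_def)

lemma map_of_table_other:
  assumes "\<And>x. c x \<noteq> d"
  shows "map_of (table k c f xs) (reg k d) = None"
  unfolding table_def map_of_eq_None_iff using assms by (auto, blast)

definition match_list :: "nat \<Rightarrow> nat list" where
  "match_list half = [0..<half]"

definition batch_list :: "nat \<Rightarrow> nat \<Rightarrow> (nat \<times> nat) list" where
  "batch_list half m = List.product [0..<half] [0..<m]"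

definition sample_list :: "nat \<Rightarrow> nat \<Rightarrow> nat \<Rightarrow> (nat \<times> nat \<times> nat) list" where
  "sample_list half m N = List.product [0..<half] (List.product [0..<m] [0..<N])"

abbreviation "sample_cell \<equiv> \<lambda>(i, j, n). Sample i j n"
abbreviation "batch_cell \<equiv> \<lambda>(i, j). Batch i j"

lemma map_of_tables [simp]:
  "map_of (table k Diff f (match_list half)) (reg k (Diff i)) = (if i < half then Some (f i) else None)"
  "map_of (table k Tally f (match_list half)) (reg k (Tally i)) = (if i < half then Some (f i) else None)"
  "map_of (table k batch_cell g (batch_list half m)) (reg k (Batch i j)) =
     (if i < half \<and> j < m then Some (g (i, j)) else None)"
  "map_of (table k sample_cell e (sample_list half m N)) (reg k (Sample i j n)) =
     (if i < half \<and> j < m \<and> n < N then Some (e (i, j, n)) else None)"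
proof -
  have "inj Diff" "inj Tally" "inj batch_cell" "inj sample_cell"
    by (auto simp: inj_def)
  note reg = this[THEN map_of_table_reg]
  show "map_of (table k Diff f (match_list half)) (reg k (Diff i)) = (if i < half then Some (f i) else None)"
    by (subst reg(1)) (simp add: match_list_def)
  show "map_of (table k Tally f (match_list half)) (reg k (Tally i)) = (if i < half then Some (f i) else None)"
    by (subst reg(2)) (simp add: match_list_def)
  show "map_of (table k batch_cell g (batch_list half m)) (reg k (Batch i j)) =
     (if i < half \<and> j < m then Some (g (i, j)) else None)"
    using reg(3)[of k g "batch_list half m" "(i, j)"] by (simp add: batch_list_def)
  show "map_of (table k sample_cell e (sample_list half m N)) (reg k (Sample i j n)) =
     (if i < half \<and> j < m \<and> n < N then Some (e (i, j, n)) else None)"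
    using reg(4)[of k e "sample_list half m N" "(i, j, n)"] by (simp add: sample_list_def)
qed

lemma map_of_tables_other [simp]:
  "map_of (table k Diff f xs) (reg k (Sample i j n)) = None"
  "map_of (table k sample_cell g ys) (reg k One) = None"
  "map_of (table k sample_cell g ys) (reg k MinusOne) = None"
  "map_of (table k sample_cell g ys) (reg k Zero) = None"
  "map_of (table k sample_cell g ys) (reg k Weight) = None"
  "map_of (table k sample_cell g ys) (reg k (Diff i)) = None"
  "map_of (table k batch_cell e zs) (reg k One) = None"
  "map_of (table k batch_cell e zs) (reg k MinusOne) = None"
  "map_of (table k batch_cell e zs) (reg k Zero) = None"
  "map_of (table k batch_cell e zs) (reg k Weight) = None"
  "map_of (table k Tally d ws) (reg k Zero) = None"
  by (rule map_of_table_other; simp split: prod.split)+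

lemma map_of_slots [simp]:
  "map_of (map (\<lambda>i. (Suc i, f i)) [0..<half]) (Suc i) = (if i < half then Some (f i) else None)"
proof -
  have "map_of (map (\<lambda>i. (Suc i, f i)) xs) (Suc i) = (if i \<in> set xs then Some (f i) else None)" for xs
    by (induction xs) auto
  then show ?thesis by simp
qed

lemma exec_phase_simps:
  "exec_phase h2 g1 \<xi> (Compute ss vs) mem =
     ((\<lambda>r. case map_of ss r of None \<Rightarrow> fst mem r | Some i \<Rightarrow> eval_sinstr h2 (fst (\<xi> r)) (fst mem) (snd mem) i),
      (\<lambda>r. case map_of vs r of None \<Rightarrow> snd mem r | Some i \<Rightarrow> eval_vinstr (fst mem) (snd mem) i))"
  "exec_phase h2 g1 \<xi> (Query qs) mem =
     (fst mem, \<lambda>r. case map_of qs r of None \<Rightarrow> snd mem r | Some a \<Rightarrow> g1 (snd mem a) (snd (\<xi> r)))"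
proof -
  obtain s v where mem: "mem = (s, v)" by (cases mem)
  show "exec_phase h2 g1 \<xi> (Compute ss vs) mem =
     ((\<lambda>r. case map_of ss r of None \<Rightarrow> fst mem r | Some i \<Rightarrow> eval_sinstr h2 (fst (\<xi> r)) (fst mem) (snd mem) i),
      (\<lambda>r. case map_of vs r of None \<Rightarrow> snd mem r | Some i \<Rightarrow> eval_vinstr (fst mem) (snd mem) i))"
    by (simp only: mem exec_phase.simps fst_conv snd_conv)
  show "exec_phase h2 g1 \<xi> (Query qs) mem =
     (fst mem, \<lambda>r. case map_of qs r of None \<Rightarrow> snd mem r | Some a \<Rightarrow> g1 (snd mem a) (snd (\<xi> r)))"
    by (simp only: mem exec_phase.simps fst_conv snd_conv)
qed

lemma exec_from_append:
  "exec_from h2 g1 \<omega> t (ps @ qs) mem = exec_from h2 g1 \<omega> (t + length ps) qs (exec_from h2 g1 \<omega> t ps mem)"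
  by (induction ps arbitrary: t mem) auto

text \<open>
  The eleven steps compute, in this order: constants and random positions \<open>u\<close>; \<open>- B\<close>; \<open>A - B\<close>; \<open>u (A - B)\<close>;
  \<open>B + u (A - B)\<close>; the answers of the oracle; the slopes; the estimates; the votes; the tallies; the
  winners. A sum of any length is one dot product, so the depth does not depend on \<open>m\<close> and \<open>N\<close>. With
  \<open>N = 0\<close> the weight \<open>1 / N\<close> is \<open>0\<close>, and the estimate is the difference of \<open>h2\<close>.
\<close>

definition round_code :: "nat \<Rightarrow> nat \<Rightarrow> nat \<Rightarrow> nat \<Rightarrow> nat \<Rightarrow> phase list" where
  "round_code k half n m N =
   (let r = reg k; opp = opponent half n; samples = sample_list half m N in
    [Compute ((r One, SConst 1) # (r MinusOne, SConst (- 1)) # (r Zero, SConst 0) #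
        (r Weight, SConst (1 / real N)) # table k sample_cell (\<lambda>_. SUnif) samples) [],
     Compute [] (table k Diff (\<lambda>i. VScale (r MinusOne) (Suc (opp i))) (match_list half)),
     Compute [] (table k Diff (\<lambda>i. VAdd (Suc i) (r (Diff i))) (match_list half)),
     Compute [] (table k sample_cell (\<lambda>(i, j, n). VScale (r (Sample i j n)) (r (Diff i))) samples),
     Compute [] (table k sample_cell (\<lambda>(i, j, n). VAdd (Suc (opp i)) (r (Sample i j n))) samples),
     Query (table k sample_cell (\<lambda>(i, j, n). r (Sample i j n)) samples),
     Compute (table k sample_cell (\<lambda>(i, j, n). SInner (r (Sample i j n)) (r (Diff i))) samples) [],
     Compute (table k batch_cell (\<lambda>(i, j). SDot ((Suc i, r One) # (Suc (opp i), r MinusOne) #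
        map (\<lambda>n. (r (Sample i j n), r Weight)) [0..<N])) (batch_list half m)) [],
     Compute (table k batch_cell (\<lambda>(i, j). SIfLe (r (Batch i j)) (r Zero) (r One) (r MinusOne))
        (batch_list half m)) [],
     Compute (table k Tally (\<lambda>i. SDot (map (\<lambda>j. (r (Batch i j), r One)) [0..<m])) (match_list half)) [],
     Compute (map (\<lambda>i. (Suc i, SIfLe (r Zero) (r (Tally i)) (Suc i) (Suc (opp i)))) [0..<half])
        (map (\<lambda>i. (Suc i, VIfLe (r Zero) (r (Tally i)) (Suc i) (Suc (opp i)))) [0..<half])])"

definition stores ::
  "(nat \<Rightarrow> real) \<times> (nat \<Rightarrow> real ^ 'n) \<Rightarrow> (nat \<Rightarrow> real ^ 'n) \<Rightarrow> (real ^ 'n \<Rightarrow> real) \<Rightarrow> nat list \<Rightarrow> bool" where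
  "stores mem x h2 ps \<longleftrightarrow>
     (\<forall>i < length ps. snd mem (Suc i) = x (ps ! i) \<and> fst mem (Suc i) = h2 (x (ps ! i)))"

text \<open>
  The samples of a match in a copy of \<open>round_code\<close> that starts at time \<open>t\<close>: the uniform number is drawn
  at once, the oracle is queried \<open>5\<close> steps later.
\<close>

definition drawn_sample :: "nat \<Rightarrow> (nat \<times> nat \<Rightarrow> real \<times> 'w) \<Rightarrow> nat \<Rightarrow> nat \<Rightarrow> nat \<Rightarrow> nat \<Rightarrow> real \<times> 'w" where
  "drawn_sample k \<omega> t i j n = (fst (\<omega> (t, reg k (Sample i j n))), snd (\<omega> (t + 5, reg k (Sample i j n))))"

lemma sum_list_upt: "(\<Sum>j\<leftarrow>[0..<m]. f j) = (\<Sum>j<m. f j :: real)"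
  by (simp add: interv_sum_list_conv_sum_set_nat atLeast0LessThan)

lemma round_code_correct:
  fixes g1 :: "real ^ 'n \<Rightarrow> 'w \<Rightarrow> real ^ 'n"
  assumes init: "stores mem x h2 ps"
    and le: "half \<le> length ps" "length ps \<le> k"
  shows "stores (exec_from h2 g1 \<omega> t (round_code k half (length ps) m N) mem) x h2
    (play_round half (\<lambda>i a b. prefers g1 h2 m N (x a) (x b) (drawn_sample k \<omega> t i)) ps)"
proof -
  let ?r = "reg k" and ?opp = "opponent half (length ps)"
  let ?code = "round_code k half (length ps) m N"
  define st where "st c = exec_from h2 g1 \<omega> t (take c ?code) mem" for c
  define A where "A i = x (ps ! i)" for i
  define B where "B i = x (ps ! ?opp i)" for i
  define u where "u i j n = fst (\<omega> (t, ?r (Sample i j n)))" for i j n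
  define w where "w i j n = snd (\<omega> (t + 5, ?r (Sample i j n)))" for i j n
  have len: "length ?code = 11"
    by (simp add: round_code_def Let_def)
  have step: "st (c + 1) = exec_phase h2 g1 (\<lambda>r. \<omega> (t + c, r)) (?code ! c) (st c)" if "c < 11" for c
    using that len by (simp add: st_def take_Suc_conv_app_nth exec_from_append)
  note exec = round_code_def Let_def exec_phase_simps
  have oppl: "?opp i < length ps" if "i < half" for i
    using that le by (auto simp: opponent_def)
  have lk: "i < k" if "i < length ps" for i
    using that le by simp
  have mh: "i < length ps" if "i < half" for i
    using that le by simp
  have s0: "fst (st 0) (Suc i) = h2 (x (ps ! i))" "snd (st 0) (Suc i) = x (ps ! i)"
    if "i < length ps" for i
    using init that by (simp_all add: st_def stores_def)
  \<comment> \<open>the memory is followed through the code one step at a time; \<open>st c\<close> is the memory after \<open>c\<close> steps\<close>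
  have st1: "st (Suc 0) = exec_phase h2 g1 (\<lambda>r. \<omega> (t, r)) (?code ! 0) (st 0)"
    using step[of 0] by simp
  have v1: "snd (st (Suc 0)) = snd (st 0)"
    by (rule ext) (simp add: st1 exec)
  have f1: "fst (st (Suc 0)) (?r One) = 1" "fst (st (Suc 0)) (?r MinusOne) = - 1" "fst (st (Suc 0)) (?r Zero) = 0"
    "fst (st (Suc 0)) (?r Weight) = 1 / real N"
    by (simp_all add: st1 exec)
  have u1: "fst (st (Suc 0)) (?r (Sample i j n)) = u i j n" if "i < half" "j < m" "n < N" for i j n
    using that by (simp add: st1 exec u_def)
  have s1: "fst (st (Suc 0)) (Suc i) = h2 (x (ps ! i))" if "i < length ps" for i
    using that lk[OF that] by (simp add: st1 exec s0)
  have st2: "st 2 = exec_phase h2 g1 (\<lambda>r. \<omega> (t + 1, r)) (?code ! 1) (st (Suc 0))"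
    using step[of 1] by (simp add: numeral_eq_Suc)
  have f2: "fst (st 2) = fst (st (Suc 0))"
    by (rule ext) (simp add: st2 exec)
  have v2: "snd (st 2) (Suc i) = x (ps ! i)" if "i < length ps" for i
    using that lk[OF that] by (simp add: st2 exec s0 v1)
  have d2: "snd (st 2) (?r (Diff i)) = - B i" if "i < half" for i
    using that oppl[OF that] by (simp add: st2 exec s0 v1 f1 B_def)
  have st3: "st 3 = exec_phase h2 g1 (\<lambda>r. \<omega> (t + 2, r)) (?code ! 2) (st 2)"
    using step[of 2] by (simp add: numeral_eq_Suc)
  have f3: "fst (st 3) = fst (st (Suc 0))"
    by (rule ext) (simp add: st3 exec f2)
  have v3: "snd (st 3) (Suc i) = x (ps ! i)" if "i < length ps" for i
    using that lk[OF that] by (simp add: st3 exec v2)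
  have d3: "snd (st 3) (?r (Diff i)) = A i - B i" if "i < half" for i
    using that mh[OF that] by (simp add: st3 exec v2 d2 A_def)
  have st4: "st 4 = exec_phase h2 g1 (\<lambda>r. \<omega> (t + 3, r)) (?code ! 3) (st 3)"
    using step[of 3] by (simp add: numeral_eq_Suc)
  have f4: "fst (st 4) = fst (st (Suc 0))"
    by (rule ext) (simp add: st4 exec f3)
  have v4: "snd (st 4) (Suc i) = x (ps ! i)" if "i < length ps" for i
    using that lk[OF that] by (simp add: st4 exec v3)
  have d4: "snd (st 4) (?r (Diff i)) = A i - B i" if "i < half" for i
    using that by (simp add: st4 exec d3)
  have e4: "snd (st 4) (?r (Sample i j n)) = u i j n *\<^sub>R (A i - B i)"
    if "i < half" "j < m" "n < N" for i j n
    using that by (simp add: st4 exec d3 f3 u1)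
  have st5: "st 5 = exec_phase h2 g1 (\<lambda>r. \<omega> (t + 4, r)) (?code ! 4) (st 4)"
    using step[of 4] by (simp add: numeral_eq_Suc)
  have f5: "fst (st 5) = fst (st (Suc 0))"
    by (rule ext) (simp add: st5 exec f4)
  have v5: "snd (st 5) (Suc i) = x (ps ! i)" if "i < length ps" for i
    using that lk[OF that] by (simp add: st5 exec v4)
  have d5: "snd (st 5) (?r (Diff i)) = A i - B i" if "i < half" for i
    using that by (simp add: st5 exec d4)
  have e5: "snd (st 5) (?r (Sample i j n)) = B i + u i j n *\<^sub>R (A i - B i)"
    if "i < half" "j < m" "n < N" for i j n
    using that oppl[OF that(1)] by (simp add: st5 exec e4 v4 B_def)
  have st6: "st 6 = exec_phase h2 g1 (\<lambda>r. \<omega> (t + 5, r)) (?code ! 5) (st 5)"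
    using step[of 5] by (simp add: numeral_eq_Suc)
  have f6: "fst (st 6) = fst (st (Suc 0))"
    by (rule ext) (simp add: st6 exec f5)
  have v6: "snd (st 6) (Suc i) = x (ps ! i)" if "i < length ps" for i
    using that lk[OF that] by (simp add: st6 exec v5)
  have d6: "snd (st 6) (?r (Diff i)) = A i - B i" if "i < half" for i
    using that by (simp add: st6 exec d5)
  have e6: "snd (st 6) (?r (Sample i j n)) = g1 (B i + u i j n *\<^sub>R (A i - B i)) (w i j n)"
    if "i < half" "j < m" "n < N" for i j n
    using that by (simp add: st6 exec e5 w_def)
  have st7: "st 7 = exec_phase h2 g1 (\<lambda>r. \<omega> (t + 6, r)) (?code ! 6) (st 6)"
    using step[of 6] by (simp add: numeral_eq_Suc)
  have v7: "snd (st 7) = snd (st 6)"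
    by (rule ext) (simp add: st7 exec)
  have f7: "fst (st 7) (?r One) = 1" "fst (st 7) (?r MinusOne) = - 1" "fst (st 7) (?r Zero) = 0"
    "fst (st 7) (?r Weight) = 1 / real N"
    by (simp_all add: st7 exec f6 f1)
  have s7: "fst (st 7) (Suc i) = h2 (x (ps ! i))" if "i < length ps" for i
    using that lk[OF that] by (simp add: st7 exec f6 s1)
  have e7: "fst (st 7) (?r (Sample i j n)) = slope g1 (A i) (B i) (drawn_sample k \<omega> t i j n)"
    if "i < half" "j < m" "n < N" for i j n
    using that by (simp add: st7 exec e6 d6 slope_def drawn_sample_def u_def w_def)
  have st8: "st 8 = exec_phase h2 g1 (\<lambda>r. \<omega> (t + 7, r)) (?code ! 7) (st 7)"
    using step[of 7] by (simp add: numeral_eq_Suc)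
  have v8: "snd (st 8) = snd (st 6)"
    by (rule ext) (simp add: st8 exec v7)
  have f8: "fst (st 8) (?r One) = 1" "fst (st 8) (?r MinusOne) = - 1" "fst (st 8) (?r Zero) = 0"
    by (simp_all add: st8 exec f7)
  have s8: "fst (st 8) (Suc i) = h2 (x (ps ! i))" if "i < length ps" for i
    using that lk[OF that] by (simp add: st8 exec s7)
  have b8: "fst (st 8) (?r (Batch i j)) = gap_estimate g1 h2 N (A i) (B i) (drawn_sample k \<omega> t i j)"
    if "i < half" "j < m" for i j
  proof -
    have "fst (st 8) (?r (Batch i j)) = h2 (A i) - h2 (B i) +
        (\<Sum>n\<leftarrow>[0..<N]. fst (st 7) (?r (Sample i j n)) * (1 / real N))"
      using that mh[OF that(1)] oppl[OF that(1)]
      by (simp add: st8 exec s7 f7 A_def B_def comp_def)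
    also have "\<dots> = gap_estimate g1 h2 N (A i) (B i) (drawn_sample k \<omega> t i j)"
      unfolding sum_list_upt gap_estimate_def sum_divide_distrib using that by (simp add: e7)
    finally show ?thesis .
  qed
  have st9: "st 9 = exec_phase h2 g1 (\<lambda>r. \<omega> (t + 8, r)) (?code ! 8) (st 8)"
    using step[of 8] by (simp add: numeral_eq_Suc)
  have v9: "snd (st 9) = snd (st 6)"
    by (rule ext) (simp add: st9 exec v8)
  have f9: "fst (st 9) (?r One) = 1" "fst (st 9) (?r Zero) = 0"
    by (simp_all add: st9 exec f8)
  have s9: "fst (st 9) (Suc i) = h2 (x (ps ! i))" if "i < length ps" for i
    using that lk[OF that] by (simp add: st9 exec s8)
  have b9: "fst (st 9) (?r (Batch i j)) =
      (if gap_estimate g1 h2 N (A i) (B i) (drawn_sample k \<omega> t i j) \<le> 0 then 1 else - 1)"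
    if "i < half" "j < m" for i j
    using that by (simp add: st9 exec b8 f8)
  have st10: "st 10 = exec_phase h2 g1 (\<lambda>r. \<omega> (t + 9, r)) (?code ! 9) (st 9)"
    using step[of 9] by (simp add: numeral_eq_Suc)
  have v10: "snd (st 10) = snd (st 6)"
    by (rule ext) (simp add: st10 exec v9)
  have f10: "fst (st 10) (?r Zero) = 0"
    by (simp add: st10 exec f9)
  have s10: "fst (st 10) (Suc i) = h2 (x (ps ! i))" if "i < length ps" for i
    using that lk[OF that] by (simp add: st10 exec s9)
  have t10: "0 \<le> fst (st 10) (?r (Tally i)) \<longleftrightarrow> prefers g1 h2 m N (A i) (B i) (drawn_sample k \<omega> t i)"
    if "i < half" for i
  proof -
    have "fst (st 10) (?r (Tally i)) = (\<Sum>j\<leftarrow>[0..<m]. fst (st 9) (?r (Batch i j)))"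
      using that by (simp add: st10 exec f9 comp_def)
    then show ?thesis
      unfolding sum_list_upt prefers_def using that by (simp add: b9)
  qed
  have st11: "st 11 = exec_phase h2 g1 (\<lambda>r. \<omega> (t + 10, r)) (?code ! 10) (st 10)"
    using step[of 10] by (simp add: numeral_eq_Suc)
  have final: "exec_from h2 g1 \<omega> t ?code mem = st 11"
    by (simp add: st_def len)
  show ?thesis
    unfolding stores_def final
  proof (intro allI impI)
    fix i
    assume "i < length (play_round half (\<lambda>i a b. prefers g1 h2 m N (x a) (x b) (drawn_sample k \<omega> t i)) ps)"
    then have i: "i < half" by (simp add: play_round_def)
    note [simp] = mh[OF i] oppl[OF i]
    show "snd (st 11) (Suc i) =
        x (play_round half (\<lambda>i a b. prefers g1 h2 m N (x a) (x b) (drawn_sample k \<omega> t i)) ps ! i) \<and>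
      fst (st 11) (Suc i) =
        h2 (x (play_round half (\<lambda>i a b. prefers g1 h2 m N (x a) (x b) (drawn_sample k \<omega> t i)) ps ! i))"
      using i by (simp add: st11 exec f10 t10 v10 v6 s10 play_round_def A_def B_def)
  qed
qed

text \<open>
  The first \<open>l\<close> rounds of a tournament with \<open>q\<close> rounds. The values of \<open>h2\<close> are computed once for all
  points; afterwards the winner of a match takes its value along.
\<close>

definition tournament_code :: "nat \<Rightarrow> nat \<Rightarrow> nat \<Rightarrow> (nat \<Rightarrow> nat) \<Rightarrow> nat \<Rightarrow> phase list" where
  "tournament_code k q m N l =
     Compute (map (\<lambda>i. (Suc i, SEvalH2 (Suc i))) [0..<k]) [] #
     concat (map (\<lambda>l. round_code k (2 ^ (q - Suc l)) (players q k l) m (N l)) [0..<l])"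

lemma length_round_code [simp]: "length (round_code k half n m N) = 11"
  by (simp add: round_code_def Let_def)

lemma length_tournament_code: "length (tournament_code k q m N l) = 1 + 11 * l"
  by (induction l) (simp_all add: tournament_code_def)

text \<open>
  The offset \<open>1 + 11 * l\<close> counts the evaluation of \<open>h2\<close> and the \<open>11\<close> steps of each earlier round.
\<close>

lemma tournament_code_correct:
  fixes g1 :: "real ^ 'n \<Rightarrow> 'w \<Rightarrow> real ^ 'n"
  assumes q: "2 ^ (q - 1) < k" "k \<le> 2 ^ q" and "l \<le> q"
  shows "stores (exec_from h2 g1 \<omega> 0 (tournament_code k q m N l) (init_mem k x)) x h2
    (survivors q k (\<lambda>l i a b. prefers g1 h2 m (N l) (x a) (x b) (drawn_sample k \<omega> (1 + 11 * l) i)) l)"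
  using \<open>l \<le> q\<close>
proof (induction l)
  case 0
  have "[1..<Suc k] ! i = Suc i" if "i < k" for i
    using that by (subst nth_upt) auto
  then show ?case
    by (simp add: tournament_code_def stores_def init_mem_def del: upt_Suc)
next
  case (Suc l)
  let ?S = "survivors q k (\<lambda>l i a b. prefers g1 h2 m (N l) (x a) (x b) (drawn_sample k \<omega> (1 + 11 * l) i)) l"
  have "2 ^ (q - Suc l) \<le> length ?S" "length ?S \<le> k"
  proof -
    show "2 ^ (q - Suc l) \<le> length ?S"
      using players_bounds(1)[OF q, of l] Suc.prems by (simp add: length_survivors)
    have "(2::nat) ^ (q - l) \<le> k" if "l \<noteq> 0"
    proof -
      have "(2::nat) ^ (q - l) \<le> 2 ^ (q - 1)"
        using that by (intro power_increasing) auto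
      also note less_imp_le[OF q(1)]
      finally show ?thesis .
    qed
    then show "length ?S \<le> k"
      by (cases "l = 0") (simp_all add: length_survivors players_def)
  qed
  from round_code_correct[OF Suc.IH this, where ?g1.0 = g1 and \<omega> = \<omega> and t = "1 + 11 * l" and m = m and N = "N l"]
    Suc.prems
  have "stores (exec_from h2 g1 \<omega> 0 (tournament_code k q m N l @
      round_code k (2 ^ (q - Suc l)) (players q k l) m (N l)) (init_mem k x)) x h2
    (play_round (2 ^ (q - Suc l)) (\<lambda>i a b. prefers g1 h2 m (N l) (x a) (x b) (drawn_sample k \<omega> (1 + 11 * l) i)) ?S)"
    unfolding exec_from_append length_tournament_code by (simp add: length_survivors)
  then show ?case
    by (simp add: tournament_code_def)
qed

section \<open>The cost of the program\<close>

lemma phase_depth_le: "phase_depth d p \<le> 1 + nat \<lceil>log 2 (real d)\<rceil>"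
proof -
  have "sdepth d i \<le> 1 + nat \<lceil>log 2 (real d)\<rceil>" for i
    by (cases i) auto
  moreover have "vdepth i \<le> 1 + nat \<lceil>log 2 (real d)\<rceil>" for i
    by simp
  ultimately show ?thesis
    by (cases p) (auto simp del: vdepth.simps)
qed

lemma computational_depth_le:
  "computational_depth d A \<le> length (phases A) * (1 + nat \<lceil>log 2 (real d)\<rceil>)"
proof -
  have "(\<Sum>p\<leftarrow>ps. phase_depth d p) \<le> length ps * (1 + nat \<lceil>log 2 (real d)\<rceil>)" for ps
  proof (induction ps)
    case (Cons p ps)
    then show ?case using phase_depth_le[of d p] by simp
  qed simp
  then show ?thesis by (simp add: computational_depth_def)
qed

lemma round_code_cost:
  "length (filter is_Query (round_code k half n m N)) = 1"
  "(\<Sum>p\<leftarrow>round_code k half n m N. phase_queries p) = half * (m * N)"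
  "(\<Sum>p\<leftarrow>round_code k half n m N. phase_h2_evals p) = 0"
  by (simp_all add: round_code_def Let_def table_def sample_list_def filter_map comp_def split_beta
      filter_empty_conv)

lemma tournament_code_cost:
  "query_depth (Algorithm (tournament_code k q m N l) out) = l"
  "num_queries (Algorithm (tournament_code k q m N l) out) = (\<Sum>l<l. 2 ^ (q - Suc l) * (m * N l))"
  "num_h2_evals (Algorithm (tournament_code k q m N l) out) = k"
proof -
  show "query_depth (Algorithm (tournament_code k q m N l) out) = l"
    unfolding query_depth_def by (induction l) (simp_all add: tournament_code_def round_code_cost)
  show "num_queries (Algorithm (tournament_code k q m N l) out) = (\<Sum>l<l. 2 ^ (q - Suc l) * (m * N l))"
    unfolding num_queries_def by (induction l) (simp_all add: tournament_code_def round_code_cost)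
  have 0: "length (filter (\<lambda>(r, i). is_SEvalH2 i) (map (\<lambda>i. (Suc i, SEvalH2 (Suc i))) [0..<k])) = k"
    by (simp add: filter_map comp_def)
  show "num_h2_evals (Algorithm (tournament_code k q m N l) out) = k"
    unfolding num_h2_evals_def
    by (induction l) (simp_all add: tournament_code_def round_code_cost 0)
qed


section \<open>The champion of the program\<close>

lemma prob_space_coins: "prob_space W \<Longrightarrow> prob_space (coins W)"
  unfolding coins_def by (intro prob_space_PiM prob_space_coin)

abbreviation duel_wins ::
  "(real ^ 'n \<Rightarrow> 'w \<Rightarrow> real ^ 'n) \<Rightarrow> (real ^ 'n \<Rightarrow> real) \<Rightarrow> (nat \<Rightarrow> real ^ 'n) \<Rightarrow> nat \<Rightarrow> nat \<Rightarrow> (nat \<Rightarrow> nat) \<Rightarrow>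
   (nat \<times> nat \<Rightarrow> real \<times> 'w) \<Rightarrow> nat \<Rightarrow> nat \<Rightarrow> nat \<Rightarrow> nat \<Rightarrow> bool" where
  "duel_wins g1 h2 x k m N \<omega> l i a b \<equiv>
     prefers g1 h2 m (N l) (x a) (x b) (drawn_sample k \<omega> (1 + 11 * l) i)"

definition champion ::
  "(real ^ 'n \<Rightarrow> 'w \<Rightarrow> real ^ 'n) \<Rightarrow> (real ^ 'n \<Rightarrow> real) \<Rightarrow> (nat \<Rightarrow> real ^ 'n) \<Rightarrow> nat \<Rightarrow> nat \<Rightarrow> nat \<Rightarrow> (nat \<Rightarrow> nat) \<Rightarrow>
   (nat \<times> nat \<Rightarrow> real \<times> 'w) \<Rightarrow> nat" where
  "champion g1 h2 x q k m N \<omega> = hd (survivors q k (duel_wins g1 h2 x k m N \<omega>) q)"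

lemma champion_in:
  assumes q: "2 ^ (q - 1) < k" "k \<le> 2 ^ q"
  shows "champion g1 h2 x q k m N \<omega> \<in> {1..k}"
proof -
  let ?S = "survivors q k (duel_wins g1 h2 x k m N \<omega>) q"
  have "length ?S = 1"
    using q by (auto simp: length_survivors players_def)
  then have "hd ?S \<in> set ?S" by (intro hd_in_set) auto
  then show ?thesis
    unfolding champion_def using set_survivors[OF q, of q] by blast
qed

lemma alg_result_champion:
  assumes q: "2 ^ (q - 1) < k" "k \<le> 2 ^ q"
  shows "alg_result (Algorithm (tournament_code k q m N q) 1) k x h2 g1 \<omega>
    = x (champion g1 h2 x q k m N \<omega>)"
proof -
  let ?S = "survivors q k (duel_wins g1 h2 x k m N \<omega>) q"
  have "length ?S = 1"
    using q by (auto simp: length_survivors players_def)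
  then show ?thesis
    using tournament_code_correct[OF q, of q h2 g1 \<omega> m N x]
    by (cases ?S) (auto simp: alg_result_def champion_def stores_def)
qed

text \<open>
  The tournament bound for the samples that the program draws. The objective \<open>f\<close> is arbitrary, to allow
  for \<open>h\<close> in the general case and for \<open>h2\<close> in the case without queries. The assumption on a single duel
  speaks of any independent family \<open>X\<close> with the law of the samples, which hides how they are drawn.
\<close>

lemma champion_prob:
  fixes g1 :: "real ^ 'n \<Rightarrow> 'w \<Rightarrow> real ^ 'n" and f e p :: "nat \<Rightarrow> real"
  assumes W: "prob_space W"
    and g1: "(\<lambda>(y, w). g1 y w) \<in> borel_measurable (borel \<Otimes>\<^sub>M W)"
    and q: "2 ^ (q - 1) < k" "k \<le> 2 ^ q"
    and duel: "\<And>l a b X. l < q \<Longrightarrow> a \<in> {1..k} \<Longrightarrow> b \<in> {1..k} \<Longrightarrow>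
      prob_space.indep_vars (coins W) (\<lambda>_. coin W) X UNIV \<Longrightarrow>
      (\<And>jn. distr (coins W) (coin W) (X jn) = coin W) \<Longrightarrow>
      measure (coins W) {\<omega>\<in>space (coins W). min (f a) (f b) + e l <
        f (if prefers g1 h2 m (N l) (x a) (x b) (\<lambda>j n. X (j, n) \<omega>) then a else b)} \<le> p l"
    and p: "\<And>l. l < q \<Longrightarrow> 0 \<le> p l"
    and Q: "\<And>i. i \<in> {1..k} \<Longrightarrow> f i \<le> (MIN i\<in>{1..k}. f i) + (\<Sum>l<q. e l) \<Longrightarrow> Q i"
  shows "1 - (\<Sum>l<q. p l) \<le> measure (coins W) {\<omega>\<in>space (coins W). Q (champion g1 h2 x q k m N \<omega>)}"
proof -
  interpret P: prob_space "coins W" by (rule prob_space_coins) fact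
  define X where "X = (\<lambda>(l, i, j, n) (\<omega> :: nat \<times> nat \<Rightarrow> real \<times> 'w). drawn_sample k \<omega> (1 + 11 * l) i j n)"
  let ?pu = "\<lambda>(l :: nat, i, j, n). (1 + 11 * l, reg k (Sample i j n))"
  let ?pw = "\<lambda>(l :: nat, i, j, n). (6 + 11 * l, reg k (Sample i j n))"
  have inj: "inj ?pu" "inj ?pw" "range ?pu \<inter> range ?pw = {}"
  proof -
    have "1 + 11 * l \<noteq> 6 + 11 * (l' :: nat)" for l l' by presburger
    then show "range ?pu \<inter> range ?pw = {}" by auto
  qed (auto simp: inj_def)
  have X: "X = (\<lambda>i \<omega>. (fst (\<omega> (?pu i)), snd (\<omega> (?pw i))))"
    by (auto simp: X_def drawn_sample_def fun_eq_iff)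
  have indep: "P.indep_vars (\<lambda>_. coin W) X UNIV"
    and distr: "distr (coins W) (coin W) (X i) = coin W" for i
    unfolding X using sampled_coins[OF W inj] by auto
  let ?T = "PiM UNIV (\<lambda>_ :: nat \<times> nat \<times> nat. coin W)"
  define Z where "Z l \<omega> = (\<lambda>c. X (l, c) \<omega>)" for l \<omega>
  have Z: "P.indep_vars (\<lambda>_. ?T) Z UNIV"
    unfolding Z_def by (rule P.indep_vars_curry[OF indep])
  then have Zm[measurable]: "Z l \<in> measurable (coins W) ?T" for l
    by (auto simp: P.indep_vars_def)
  define wins where "wins l i a b z = prefers g1 h2 m (N l) (x a) (x b) (\<lambda>j n. z (i, j, n))"
    for l i a b and z :: "nat \<times> nat \<times> nat \<Rightarrow> real \<times> 'w"
  have wins_meas[measurable]: "Measurable.pred ?T (wins l i a b)" for l i a b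
  proof -
    have "(\<lambda>z j n. z (i, j, n)) \<in> measurable ?T (PiM UNIV (\<lambda>_. PiM UNIV (\<lambda>_. coin W)))"
      by (intro measurable_PiM_single') (auto simp: space_PiM PiE_iff)
    from measurable_compose[OF this measurable_prefers[OF g1]] show ?thesis
      unfolding wins_def .
  qed
  have champion: "champion g1 h2 x q k m N \<omega> = hd (survivors q k (\<lambda>l i a b. wins l i a b (Z l \<omega>)) q)" for \<omega>
    by (simp add: champion_def wins_def Z_def X_def)
  have [measurable]: "(\<lambda>\<omega>. survivors q k (\<lambda>l i a b. wins l i a b (Z l \<omega>)) q)
      \<in> measurable (coins W) (count_space UNIV)"
    by (rule measurable_survivors) simp
  then have meas[measurable]: "champion g1 h2 x q k m N \<in> measurable (coins W) (count_space UNIV)"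
    unfolding champion[abs_def] by (rule measurable_compose) simp
  have ev: "{\<omega>\<in>space (coins W). Q' (champion g1 h2 x q k m N \<omega>)} \<in> sets (coins W)" for Q'
  proof -
    have [measurable]: "Measurable.pred (count_space UNIV) Q'" by simp
    show ?thesis by measurable
  qed
  have "P.prob {\<omega>\<in>space (coins W). (MIN i\<in>{1..k}. f i) + (\<Sum>l<q. e l) < f (champion g1 h2 x q k m N \<omega>)}
      \<le> (\<Sum>l<q. p l)"
    unfolding champion
  proof (rule P.tournament[OF q Z wins_meas _ p])
    fix l i a b assume l: "l < q" and ab: "a \<in> {1..k}" "b \<in> {1..k}"
    have "P.indep_vars (\<lambda>_. coin W) (\<lambda>jn. X (l, i, jn)) UNIV"
      by (rule P.indep_vars_reindex[OF indep]) (auto simp: inj_def)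
    from duel[OF l ab this distr]
    show "P.prob {\<omega>\<in>space (coins W). min (f a) (f b) + e l < f (if wins l i a b (Z l \<omega>) then a else b)} \<le> p l"
      by (simp add: wins_def Z_def)
  qed
  moreover have "P.prob {\<omega>\<in>space (coins W). (MIN i\<in>{1..k}. f i) + (\<Sum>l<q. e l) < f (champion g1 h2 x q k m N \<omega>)}
    = 1 - P.prob {\<omega>\<in>space (coins W). \<not> (MIN i\<in>{1..k}. f i) + (\<Sum>l<q. e l) < f (champion g1 h2 x q k m N \<omega>)}"
    using P.prob_neg[of "\<lambda>\<omega>. \<not> (MIN i\<in>{1..k}. f i) + (\<Sum>l<q. e l) < f (champion g1 h2 x q k m N \<omega>)"]
      ev[of "\<lambda>c. \<not> (MIN i\<in>{1..k}. f i) + (\<Sum>l<q. e l) < f c"] by simp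
  moreover have "P.prob {\<omega>\<in>space (coins W). \<not> (MIN i\<in>{1..k}. f i) + (\<Sum>l<q. e l) < f (champion g1 h2 x q k m N \<omega>)}
    \<le> P.prob {\<omega>\<in>space (coins W). Q (champion g1 h2 x q k m N \<omega>)}"
    by (rule P.finite_measure_mono[OF _ ev]) (auto simp: not_less intro: Q[OF champion_in[OF q]] simp del: One_nat_def)
  ultimately show "1 - (\<Sum>l<q. p l) \<le> P.prob {\<omega>\<in>space (coins W). Q (champion g1 h2 x q k m N \<omega>)}"
    by linarith
qed

section \<open>Choice of the parameters\<close>

lemma log2_le_ln:
  assumes "1 \<le> x"
  shows "log 2 x \<le> 3 / 2 * ln x"
proof -
  have "ln x * 1 \<le> ln x * (3 / 2 * ln 2)"
    using assms ln2_ge_two_thirds by (intro mult_left_mono) auto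
  then show ?thesis by (simp add: log_def divide_le_eq mult_ac)
qed

lemma rounds_bounds:
  assumes "2 \<le> k"
  shows "1 \<le> ceillog2 k" "2 ^ (ceillog2 k - 1) < k" "k \<le> 2 ^ ceillog2 k" "real (ceillog2 k) \<le> 3 * ln (real k)"
proof -
  show le: "k \<le> 2 ^ ceillog2 k" by (rule le_two_power_ceillog2)
  show 1: "1 \<le> ceillog2 k"
    using assms by (simp add: ceillog2_ge_iff)
  have "2 * 2 ^ (ceillog2 k - 1) = (2::nat) ^ ceillog2 k"
    using 1 by (simp flip: power_Suc)
  then show "2 ^ (ceillog2 k - 1) < k"
    using two_power_ceillog2_gt[of k] assms by linarith
  have "real (ceillog2 k) \<le> log 2 k + 1"
    using ceillog2_less_log[of k] assms by simp
  also have "1 \<le> log 2 k"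
    using assms by simp
  also have "log 2 k \<le> 3 / 2 * ln k"
    using assms by (intro log2_le_ln) simp
  finally show "real (ceillog2 k) \<le> 3 * ln (real k)" by simp
qed

text \<open>
  The least number of votes for which the failure probability \<open>(1 / 2) ^ m\<close> of a duel is at most
  \<open>\<delta> / q\<close>.
\<close>

definition votes :: "nat \<Rightarrow> real \<Rightarrow> nat" where
  "votes q \<delta> = nat \<lceil>log 2 (real q / \<delta>)\<rceil>"

lemma votes_bounds:
  assumes "1 \<le> q" "0 < \<delta>" "\<delta> < 1"
  shows "0 < votes q \<delta>" "(1 / 2) ^ votes q \<delta> \<le> \<delta> / real q"
proof -
  have gt: "1 < real q / \<delta>"
    using assms by (simp add: less_divide_eq)
  then have "0 < log 2 (real q / \<delta>)" by simp
  then show "0 < votes q \<delta>" by (simp add: votes_def)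
  have "real q / \<delta> \<le> 2 powr real (votes q \<delta>)"
    using gt by (simp add: votes_def flip: log_le_iff)
  then show "(1 / 2) ^ votes q \<delta> \<le> \<delta> / real q"
    using assms by (simp add: powr_realpow power_divide field_simps)
qed

lemma votes_le:
  assumes "2 \<le> k" "0 < \<delta>" "\<delta> < 1"
  shows "real (votes (ceillog2 k) \<delta>) \<le> 6 * ln1 (ln (real k) / \<delta>)"
proof -
  let ?q = "ceillog2 k"
  note q = rounds_bounds[OF assms(1)]
  have gt: "1 < real ?q / \<delta>"
    using assms q(1) by (simp add: less_divide_eq)
  have lnk: "0 < ln (real k)" using assms by simp
  have "real (votes ?q \<delta>) \<le> log 2 (real ?q / \<delta>) + 1"
    using gt by (simp add: votes_def)
  also have "log 2 (real ?q / \<delta>) \<le> 3 / 2 * ln (real ?q / \<delta>)"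
    using gt by (intro log2_le_ln) simp
  also have "ln (real ?q / \<delta>) \<le> ln (3 * (ln (real k) / \<delta>))"
    using q(4) gt assms lnk q(1) by (subst ln_le_cancel_iff) (auto simp: divide_right_mono)
  also have "\<dots> = ln 3 + ln (ln (real k) / \<delta>)"
    using assms lnk by (subst ln_mult) auto
  also have "ln (3 :: real) \<le> 2"
    using ln_le_minus_one[of 3] by simp
  also have "ln (ln (real k) / \<delta>) \<le> ln1 (ln (real k) / \<delta>)"
    by (simp add: ln1_def)
  finally have "real (votes ?q \<delta>) \<le> 3 / 2 * (2 + ln1 (ln (real k) / \<delta>)) + 1" by simp
  moreover have "1 \<le> ln1 (ln (real k) / \<delta>)" by (simp add: ln1_def)
  ultimately show ?thesis by (simp add: field_simps)
qed

definition tolerance :: "real \<Rightarrow> nat \<Rightarrow> real" where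
  "tolerance \<epsilon> l = \<epsilon> / 4 * (3 / 4) ^ l"

text \<open>
  Here \<open>r\<close> stands for \<open>L\<^sup>2 R\<^sup>2 / \<epsilon>\<^sup>2\<close>, and \<open>256 r (16 / 9) ^ l\<close> is \<open>16 L\<^sup>2 R\<^sup>2\<close> divided by the square of
  \<open>tolerance \<epsilon> l\<close>.
\<close>

definition batch_size :: "real \<Rightarrow> nat \<Rightarrow> nat" where
  "batch_size r l = nat \<lceil>256 * r * (16 / 9) ^ l\<rceil>"

lemma sum_tolerance: 
  assumes "0 \<le> \<epsilon>"
  shows "(\<Sum>l<q. tolerance \<epsilon> l) \<le> \<epsilon>"
proof -
  have "(\<Sum>l<q. tolerance \<epsilon> l) = \<epsilon> * (1 - (3 / 4) ^ q)"
    by (induction q) (simp_all add: tolerance_def algebra_simps)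
  also have "\<dots> \<le> \<epsilon> * 1"
    using assms by (intro mult_left_mono) auto
  finally show ?thesis by simp
qed

lemma batch_size_ge:
  assumes "0 < \<epsilon>"
  shows "16 * s \<le> real (batch_size (s / \<epsilon>\<^sup>2) l) * (tolerance \<epsilon> l)\<^sup>2"
proof -
  have eq: "(16 / 9 :: real) ^ l * ((3 / 4) ^ l)\<^sup>2 = 1"
    by (simp add: power_mult_distrib[symmetric] power2_eq_square)
  have "16 * s = 16 * s * ((16 / 9) ^ l * ((3 / 4) ^ l)\<^sup>2)"
    by (simp only: eq mult_1_right)
  also have "\<dots> = 256 * (s / \<epsilon>\<^sup>2) * (16 / 9) ^ l * (tolerance \<epsilon> l)\<^sup>2"
    using assms by (simp add: tolerance_def power_mult_distrib power_divide field_simps)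
  also have "\<dots> \<le> real (batch_size (s / \<epsilon>\<^sup>2) l) * (tolerance \<epsilon> l)\<^sup>2"
    unfolding batch_size_def by (intro mult_right_mono real_nat_ceiling_ge) simp
  finally show ?thesis .
qed

lemma batch_size_bounds:
  assumes "1 \<le> r"
  shows "0 < batch_size r l" "real (batch_size r l) \<le> 257 * r * (16 / 9) ^ l"
proof -
  have 1: "1 \<le> r * (16 / 9) ^ l"
    using assms mult_mono[of 1 r 1 "(16 / 9) ^ l"] by simp
  then show "0 < batch_size r l" by (simp add: batch_size_def) 
  have "real (batch_size r l) \<le> 256 * r * (16 / 9) ^ l + 1"
    using 1 by (simp add: batch_size_def)
  then show "real (batch_size r l) \<le> 257 * r * (16 / 9) ^ l"
    using 1 by linarith
qed

text \<open>
  Halving the number of matches beats the growth of the batches by \<open>16 / 9\<close>: the terms decay like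
  \<open>(8 / 9) ^ l\<close>, so the sum is at most \<open>9\<close> times the first term, and \<open>2313 = 9 * 257\<close>.
\<close>

lemma total_samples_le:
  assumes r: "1 \<le> r" and q: "1 \<le> q"
  shows "(\<Sum>l<q. 2 ^ (q - Suc l) * real (batch_size r l)) \<le> 2 ^ (q - 1) * (2313 * r)"
proof -
  have "(\<Sum>l<q. 2 ^ (q - Suc l) * real (batch_size r l)) \<le> (\<Sum>l<q. 2 ^ (q - 1) * (257 * r) * (8 / 9) ^ l)"
  proof (rule sum_mono)
    fix l assume "l \<in> {..<q}"
    then have "(q - 1) = (q - Suc l) + l" by auto
    then have "(2::real) ^ (q - 1) * (8 / 9) ^ l = 2 ^ (q - Suc l) * (2 ^ l * (8 / 9) ^ l)"
      by (metis (no_types, lifting) mult.assoc power_add)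
    also have "(2::real) ^ l * (8 / 9) ^ l = (16 / 9) ^ l"
      by (simp flip: power_mult_distrib)
    finally have "2 ^ (q - 1) * (257 * r) * (8 / 9) ^ l = 2 ^ (q - Suc l) * (257 * r * (16 / 9) ^ l)"
      by (simp add: algebra_simps)
    note eq = this
    have "2 ^ (q - Suc l) * real (batch_size r l) \<le> 2 ^ (q - Suc l) * (257 * r * (16 / 9) ^ l)"
      by (intro mult_left_mono batch_size_bounds(2) r) simp
    then show "2 ^ (q - Suc l) * real (batch_size r l) \<le> 2 ^ (q - 1) * (257 * r) * (8 / 9) ^ l"
      by (simp only: eq)
  qed
  also have "\<dots> = 2 ^ (q - 1) * (257 * r) * (\<Sum>l<q. (8 / 9) ^ l)"
    by (simp add: sum_distrib_left)
  also have "(\<Sum>l<q. (8 / 9 :: real) ^ l) = 9 * (1 - (8 / 9) ^ q)"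
    by (induction q) (simp_all add: algebra_simps)
  also have "2 ^ (q - 1) * (257 * r) * (9 * (1 - (8 / 9) ^ q)) \<le> 2 ^ (q - 1) * (257 * r) * (9 * 1)"
    using r by (intro mult_left_mono) auto
  finally show ?thesis by simp
qed

lemma tournament_depth_le:
  assumes "2 \<le> k" "1 \<le> d"
  shows "real (computational_depth d (Algorithm (tournament_code k (ceillog2 k) m N (ceillog2 k)) out))
    \<le> 100 * ((ln (real d) + 1) * ln (real k))"
proof -
  let ?q = "ceillog2 k" and ?A = "Algorithm (tournament_code k (ceillog2 k) m N (ceillog2 k)) out"
  have q: "1 \<le> ?q" "real ?q \<le> 3 * ln (real k)"
    using rounds_bounds[OF assms(1)] by auto
  have lnd: "0 \<le> ln (real d)" using assms by simp
  have "0 \<le> log 2 (real d)" using assms by simp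
  then have "real (nat \<lceil>log 2 (real d)\<rceil>) \<le> log 2 (real d) + 1" by linarith
  also have "log 2 (real d) \<le> 3 / 2 * ln (real d)"
    using assms by (intro log2_le_ln) simp
  finally have dot: "1 + real (nat \<lceil>log 2 (real d)\<rceil>) \<le> 2 + 3 / 2 * ln (real d)" by simp
  have "real (computational_depth d ?A) \<le> real ((1 + 11 * ?q) * (1 + nat \<lceil>log 2 (real d)\<rceil>))"
    using computational_depth_le[of d ?A] length_tournament_code[of k ?q m N ?q] by (simp del: of_nat_mult)
  also have "\<dots> = (1 + 11 * real ?q) * (1 + real (nat \<lceil>log 2 (real d)\<rceil>))"
    by (simp add: algebra_simps)
  also have "\<dots> \<le> (36 * ln (real k)) * (2 + 3 / 2 * ln (real d))"
    using q dot lnd by (intro mult_mono) auto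
  also have "\<dots> \<le> (36 * ln (real k)) * (2 * (ln (real d) + 1))"
    using lnd assms by (intro mult_left_mono) auto
  also have "\<dots> \<le> 100 * ((ln (real d) + 1) * ln (real k))"
    using lnd assms by (simp add: algebra_simps mult_nonneg_nonneg)
  finally show ?thesis .
qed

theorem proposition3:
  fixes k :: nat and L R \<epsilon> \<delta> :: real
  assumes "k \<ge> 1" and "L \<ge> 0" and "R \<ge> 0" and "\<epsilon> > 0" and "0 < \<delta>" and "\<delta> < 1"
  shows "\<exists>A :: algorithm.
    real (num_queries A) \<le> O_const * (L\<^sup>2 * R\<^sup>2 / \<epsilon>\<^sup>2 * (real k * ln1 (ln (real k) / \<delta>))) \<and>
    num_h2_evals A \<le> k \<and>
    real (query_depth A) \<le> O_const * ln (real k) \<and>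
    real (computational_depth CARD('n::finite) A)
      \<le> O_const * ((ln (real CARD('n)) + ln1 (ln (real k / \<delta>))) * ln (real k)) \<and>
    (\<forall>(h :: real ^ 'n \<Rightarrow> real) h1 h2 (xstar :: real ^ 'n) (x :: nat \<Rightarrow> real ^ 'n)
       (g1 :: real ^ 'n \<Rightarrow> 'w \<Rightarrow> real ^ 'n) (W :: 'w measure).
       h differentiable_on UNIV \<longrightarrow>
       (\<forall>y. h xstar \<le> h y) \<longrightarrow>
       (\<forall>y. h y = h1 y + h2 y) \<longrightarrow>
       (\<forall>i\<in>{1..k}. \<forall>j\<in>{1..k}. norm (x i - x j) \<le> R) \<longrightarrow>
       (MIN i\<in>{1..k}. h (x i)) - h xstar \<le> \<epsilon> \<longrightarrow>
       prob_space W \<longrightarrow>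
       (\<lambda>(y, w). g1 y w) \<in> borel_measurable (borel \<Otimes>\<^sub>M W) \<longrightarrow>
       (\<forall>y \<in> convex hull (x ` {1..k}).
          GDERIV h1 y :> (\<integral>w. g1 y w \<partial>W) \<and>
          integrable W (\<lambda>w. (norm (g1 y w))\<^sup>2) \<and>
          (\<integral>w. (norm (g1 y w))\<^sup>2 \<partial>W) \<le> L\<^sup>2) \<longrightarrow>
       (\<forall>\<omega> \<in> space (coins W). alg_result A k x h2 g1 \<omega> \<in> x ` {1..k}) \<and>
       measure (coins W)
         {\<omega> \<in> space (coins W). h (alg_result A k x h2 g1 \<omega>) - h xstar \<le> 2 * \<epsilon>} \<ge> 1 - \<delta>)"
proof (cases "k = 1")
  case True
  \<comment> \<open>with a single point the bounds contain the factor \<open>ln 1 = 0\<close>, so the program must be empty\<close>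
  let ?A = "Algorithm [] 1"
  have res: "alg_result ?A k x h2 g1 \<omega> = x 1"
    for x :: "nat \<Rightarrow> real ^ 'n" and h2 and g1 :: "real ^ 'n \<Rightarrow> 'w \<Rightarrow> real ^ 'n" and \<omega>
    using True by (simp add: alg_result_def init_mem_def)
  show ?thesis
  proof (intro exI[of _ ?A] conjI allI impI, goal_cases)
    case (5 h h1 h2 xstar x g1 W)
    then show ?case unfolding res using True by simp
  next
    case (6 h h1 h2 xstar x g1 W)
    interpret P: prob_space "coins W" by (rule prob_space_coins) fact
    have "h (x 1) - h xstar \<le> 2 * \<epsilon>"
      using 6(5) True assms(4) by simp
    then show ?case
      unfolding res using assms P.prob_space by simp
  qed (use True assms in \<open>auto simp: num_queries_def num_h2_evals_def query_depth_def computational_depth_def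
        O_const_def ln1_def res\<close>)
next
  case False
  then have k: "2 \<le> k" using assms by simp
  define q where "q = ceillog2 k"
  note q = rounds_bounds[OF k, folded q_def]
  define \<rho> where "\<rho> = L\<^sup>2 * R\<^sup>2 / \<epsilon>\<^sup>2"
  \<comment> \<open>the case in which the query bound need not allow a single query\<close>
  define easy where "easy \<longleftrightarrow> L * R \<le> \<epsilon>"
  define m where "m = (if easy then 1 else votes q \<delta>)"
  define N where "N l = (if easy then 0 else batch_size \<rho> l)" for l
  let ?A = "Algorithm (tournament_code k q m N q) 1"
  have \<rho>: "1 \<le> \<rho>" if "\<not> easy"
  proof -
    have "\<epsilon>\<^sup>2 \<le> (L * R)\<^sup>2"
      using that assms by (intro power_mono) (auto simp: easy_def)
    then show ?thesis
      using assms by (simp add: \<rho>_def power_mult_distrib)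
  qed
  have lnk: "0 < ln (real k)" using k by simp
  have ln1: "1 \<le> ln1 y" for y by (simp add: ln1_def)
  show ?thesis
  proof (intro exI[of _ ?A] conjI allI impI, goal_cases)
    case 1
    show ?case
    proof (cases easy)
      case True
      then have "num_queries ?A = 0" by (simp add: tournament_code_cost N_def)
      then show ?thesis
        using ln1[of "ln (real k) / \<delta>"] by (simp add: O_const_def)
    next
      case hard: False
      have "real (num_queries ?A) = real m * (\<Sum>l<q. 2 ^ (q - Suc l) * real (batch_size \<rho> l))"
        using hard by (simp add: tournament_code_cost N_def sum_distrib_left algebra_simps)
      also have "\<dots> \<le> (6 * ln1 (ln (real k) / \<delta>)) * (2 ^ (q - 1) * (2313 * \<rho>))"
        using hard votes_le[OF k assms(5,6)] total_samples_le[OF \<rho>[OF hard] q(1)]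
          ln1[of "ln (real k) / \<delta>"]
        by (intro mult_mono) (auto simp: m_def q_def sum_nonneg)
      also have "\<dots> \<le> (6 * ln1 (ln (real k) / \<delta>)) * (real k * (2313 * \<rho>))"
      proof -
        have "2 ^ (q - 1) \<le> real k"
          using q(2) by (metis less_imp_le of_nat_le_iff of_nat_numeral of_nat_power)
        then show ?thesis
          using ln1[of "ln (real k) / \<delta>"] \<rho>[OF hard] by (intro mult_left_mono mult_right_mono) auto
      qed
      also have "\<dots> = 13878 * (\<rho> * (real k * ln1 (ln (real k) / \<delta>)))"
        by simp
      also have "\<dots> \<le> O_const * (\<rho> * (real k * ln1 (ln (real k) / \<delta>)))"
        using ln1[of "ln (real k) / \<delta>"] \<rho>[OF hard] by (intro mult_right_mono) (auto simp: O_const_def)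
      finally show ?thesis by (simp add: \<rho>_def)
    qed
  next
    case 2
    show ?case by (simp add: tournament_code_cost)
  next
    case 3
    show ?case using q(4) lnk by (simp add: tournament_code_cost O_const_def)
  next
    case 4
    have "real (computational_depth CARD('n) ?A) \<le> 100 * ((ln (real CARD('n)) + 1) * ln (real k))"
      unfolding q_def by (rule tournament_depth_le[OF k]) simp
    also have "\<dots> \<le> O_const * ((ln (real CARD('n)) + ln1 (ln (real k / \<delta>))) * ln (real k))"
      using lnk ln1[of "ln (real k / \<delta>)"] by (intro mult_mono mult_right_mono) (auto simp: O_const_def)
    finally show ?case .
  next
    case (5 h h1 h2 xstar x g1 W)
    show ?case
      using champion_in[OF q(2,3)] alg_result_champion[OF q(2,3)] by blast
  next
    case (6 h h1 h2 xstar x g1 W)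
    interpret P: prob_space "coins W" by (rule prob_space_coins) fact
    let ?c = "champion g1 h2 x q k m N"
    have hsplit: "h y = h1 y + h2 y" for y using 6(3) by blast
    have mom: "integrable (coin W) (\<lambda>z. (slope g1 (x a) (x b) z)\<^sup>2)"
        "(\<integral>z. (slope g1 (x a) (x b) z)\<^sup>2 \<partial>coin W) \<le> L\<^sup>2 * R\<^sup>2"
        "(\<integral>z. slope g1 (x a) (x b) z \<partial>coin W) = h1 (x a) - h1 (x b)"
      if "a \<in> {1..k}" "b \<in> {1..k}" for a b
    proof -
      have "x a \<in> convex hull (x ` {1..k})" "x b \<in> convex hull (x ` {1..k})"
        using that by (auto intro: hull_inc)
      note slope_moments[OF 6(6,7) convex_convex_hull this]
      note * = this[where ?h1.0 = h1 and L = L and R = R]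
      show "integrable (coin W) (\<lambda>z. (slope g1 (x a) (x b) z)\<^sup>2)"
        "(\<integral>z. (slope g1 (x a) (x b) z)\<^sup>2 \<partial>coin W) \<le> L\<^sup>2 * R\<^sup>2"
        "(\<integral>z. slope g1 (x a) (x b) z \<partial>coin W) = h1 (x a) - h1 (x b)"
        using 6(4,8) that by (auto intro!: *)
    qed
    have best: "(MIN i\<in>{1..k}. h (x i)) \<le> h xstar + \<epsilon>" using 6(5) by simp
    have "1 - \<delta> \<le> P.prob {\<omega>\<in>space (coins W). h (x (?c \<omega>)) - h xstar \<le> 2 * \<epsilon>}"
    proof (cases easy)
      case True
      have "1 - (\<Sum>l<q. 0) \<le> P.prob {\<omega>\<in>space (coins W). h (x (?c \<omega>)) - h xstar \<le> 2 * \<epsilon>}"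
      proof (rule champion_prob[OF 6(6,7) q(2,3), where f = "\<lambda>i. h2 (x i)" and e = "\<lambda>_. 0"
            and Q = "\<lambda>i. h (x i) - h xstar \<le> 2 * \<epsilon>"])
        fix l a b and X :: "nat \<times> nat \<Rightarrow> (nat \<times> nat \<Rightarrow> real \<times> 'w) \<Rightarrow> real \<times> 'w"
        \<comment> \<open>one empty batch compares the values of \<open>h2\<close>, without any error\<close>
        have "prefers g1 h2 m (N l) (x a) (x b) z \<longleftrightarrow> h2 (x a) \<le> h2 (x b)" for z
          using True by (simp add: prefers_def gap_estimate_def m_def N_def)
        then show "P.prob {\<omega>\<in>space (coins W). min (h2 (x a)) (h2 (x b)) + 0 <
            h2 (x (if prefers g1 h2 m (N l) (x a) (x b) (\<lambda>j n. X (j, n) \<omega>) then a else b))} \<le> 0"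
          by (simp add: min_def)
      next
        fix i assume i: "i \<in> {1..k}" "h2 (x i) \<le> (MIN i\<in>{1..k}. h2 (x i)) + (\<Sum>l<q. 0)"
        have "(MIN i\<in>{1..k}. h (x i)) \<in> (\<lambda>i. h (x i)) ` {1..k}"
          using k by (intro Min_in) auto
        then obtain b where b: "b \<in> {1..k}" "(MIN i\<in>{1..k}. h (x i)) = h (x b)" by auto
        have "h2 (x i) \<le> h2 (x b)"
          using i(2) b(1) Min_le[of "(\<lambda>i. h2 (x i)) ` {1..k}" "h2 (x b)"] by auto
        moreover have "\<bar>h1 (x i) - h1 (x b)\<bar> \<le> L * R"
          using prob_space.abs_expectation_le[OF prob_space_coin[OF 6(6)] measurable_slope[OF 6(7)]
              mom(1)[OF i(1) b(1)], of "L * R"]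
            mom(2,3)[OF i(1) b(1)] assms by (simp add: power_mult_distrib)
        ultimately show "h (x i) - h xstar \<le> 2 * \<epsilon>"
          using best b(2) True hsplit[of "x i"] hsplit[of "x b"] by (simp add: easy_def)
      qed simp
      then show ?thesis using assms by simp
    next
      case hard: False
      have "1 - (\<Sum>l<q. \<delta> / real q) \<le> P.prob {\<omega>\<in>space (coins W). h (x (?c \<omega>)) - h xstar \<le> 2 * \<epsilon>}"
      proof (rule champion_prob[OF 6(6,7) q(2,3), where f = "\<lambda>i. h (x i)" and e = "tolerance \<epsilon>"
            and Q = "\<lambda>i. h (x i) - h xstar \<le> 2 * \<epsilon>"])
        fix l a b and X :: "nat \<times> nat \<Rightarrow> (nat \<times> nat \<Rightarrow> real \<times> 'w) \<Rightarrow> real \<times> 'w"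
        assume ab: "a \<in> {1..k}" "b \<in> {1..k}" and X: "P.indep_vars (\<lambda>_. coin W) X UNIV"
          "\<And>jn. distr (coins W) (coin W) (X jn) = coin W"
        have "P.prob {\<omega>\<in>space (coins W). min (h (x a)) (h (x b)) + tolerance \<epsilon> l <
            h (if prefers g1 h2 m (N l) (x a) (x b) (\<lambda>j n. X (j, n) \<omega>) then x a else x b)} \<le> (1 / 2) ^ m"
        proof (rule P.duel_error[OF X 6(7) mom[OF ab] hsplit])
          show "0 < N l" "16 * (L\<^sup>2 * R\<^sup>2) \<le> real (N l) * (tolerance \<epsilon> l)\<^sup>2"
            using hard batch_size_bounds(1)[OF \<rho>[OF hard]] batch_size_ge[OF assms(4), of "L\<^sup>2 * R\<^sup>2" l]
            by (auto simp: N_def \<rho>_def)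
          show "0 < tolerance \<epsilon> l" using assms by (simp add: tolerance_def)
          show "0 < m" using hard votes_bounds(1)[OF q(1) assms(5,6)] by (simp add: m_def)
        qed
        also have "(1 / 2) ^ m \<le> \<delta> / real q"
          using hard votes_bounds(2)[OF q(1) assms(5,6)] by (simp add: m_def)
        finally show "P.prob {\<omega>\<in>space (coins W). min (h (x a)) (h (x b)) + tolerance \<epsilon> l <
            h (x (if prefers g1 h2 m (N l) (x a) (x b) (\<lambda>j n. X (j, n) \<omega>) then a else b))} \<le> \<delta> / real q"
          by (simp add: if_distrib[of x])
      next
        fix i assume "h (x i) \<le> (MIN i\<in>{1..k}. h (x i)) + (\<Sum>l<q. tolerance \<epsilon> l)"
        then show "h (x i) - h xstar \<le> 2 * \<epsilon>"
          using best sum_tolerance[of \<epsilon> q] assms by linarith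
      qed (use assms in auto)
      then show ?thesis using q(1) by simp
    qed
    then show ?case
      unfolding alg_result_champion[OF q(2,3)] .
  qed
qed

end
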